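(* Let $0<\alpha<1$, $\theta>-\alpha$, and let $g:(0,\infty)\to[0,\infty)$ be a function such that $$1/\Sigma_{\alpha,\theta}:=\mathbb{E}[g(G_{\theta/\alpha+1}\,\beta^{\alpha}_{\theta+\alpha,1-\alpha})]\in(0,\infty).$$ Let $$\gamma_\alpha(t)=\Sigma_{\alpha,\theta}\,\mathbb{E}\left[g\!\left(\frac{G^\alpha_{\theta+\alpha}}{t^\alpha}\right)\right]f_{\alpha,\theta}(t),\qquad t>0,$$ that is, $\gamma_\alpha=hf_\alpha$ with $h(t)=\frac{\Gamma(\theta+1)}{\Gamma(\theta/\alpha+1)}\Sigma_{\alpha,\theta}t^{-\theta}\mathbb{E}[g(G^\alpha_{\theta+\alpha}/t^\alpha)]$. Then the Poisson–Kingman model $\mathrm{PK}(\rho_\alpha,\gamma_\alpha)$ has the following properties. (i) For $n=1,2,\ldots$, $$V_{n,1}=\frac{\Gamma(\theta+1)}{\Gamma(n+\theta)}\,\Sigma_{\alpha,\theta}\,\mathbb{E}[g(G_{\theta/\alpha+1}\,\beta^\alpha_{\theta+\alpha,n-\alpha})].$$ (ii) For $k=1,2,\ldots,n$, $$V_{n,k}=\frac{\alpha^{k-1}\Gamma(\theta+1)\Gamma(\theta/\alpha+k)}{\Gamma(\theta/\alpha+1)\Gamma(n+\theta)}\,\Sigma_{\alpha,\theta}\,\mathbb{E}[g(G_{\theta/\alpha+k}\,\beta^\alpha_{\theta+\alpha,n-\alpha})].$$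
   Context: $f_\alpha$ is the density on $(0,\infty)$ of the positive $\alpha$-stable variable with Laplace transform $e^{-\lambda^\alpha}$, and $f_{\alpha,\theta}(t)=\frac{\Gamma(\theta+1)}{\Gamma(\theta/\alpha+1)}t^{-\theta}f_\alpha(t)$ for $\theta>-\alpha$. $G_a$ is a gamma$(a,1)$ variable and $\beta_{a,b}$ a beta$(a,b)$ variable; variables in the same product are independent. $V_{n,k}=\int_0^\infty\mathbb{G}^{(n,k)}_\alpha(t)\gamma_\alpha(t)dt$ with $\mathbb{G}_{\alpha}^{(n,k)}(t)=\frac{\alpha^{k}t^{-k\alpha}}{\Gamma(n-k\alpha)f_{\alpha}(t)}\int_{0}^{1}f_{\alpha}(tu)(1-u)^{n-k\alpha-1}du$; the EPPF of $\mathrm{PK}(\rho_\alpha,\gamma_\alpha)$ (the partition generated by the normalized ranked jumps of an $\alpha$-stable subordinator conditioned on total mass $t$, with $t$ mixed over $\gamma_\alpha$) is $V_{n,k}\prod_{j=1}^k\Gamma(n_j-\alpha)/\Gamma(1-\alpha)$. *)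

theory Defs
  imports "HOL-Probability.Probability"
begin

text \<open>
  All integrands and densities below are nonnegative, so expectations and integrals are taken
  in \<open>[0, \<infinity>]\<close>, as Lebesgue integrals with values in \<^typ>\<open>ennreal\<close>. Functions on
  \<open>(0, \<infinity>)\<close> are rendered by functions on \<^typ>\<open>real\<close> whose values outside
  \<open>(0, \<infinity>)\<close> are irrelevant.
\<close>

text \<open>
  The case \<open>s = 0\<close> of the Laplace transform says that \<open>f\<close> has total mass \<open>1\<close>
  (note that \<open>0 powr \<alpha> = 0\<close>). A density is determined only up to a null set;
  no particular version is singled out.
\<close>

definition positive_stable_density :: "real \<Rightarrow> (real \<Rightarrow> real) \<Rightarrow> bool" where
  "positive_stable_density \<alpha> f \<longleftrightarrow>
     f \<in> borel_measurable (restrict_space borel {0<..}) \<and>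
     (\<forall>t>0. 0 \<le> f t) \<and>
     (\<forall>s\<ge>0. (\<integral>\<^sup>+t\<in>{0<..}. ennreal (exp (- (s * t)) * f t) \<partial>lborel)
            = ennreal (exp (- (s powr \<alpha>))))"

text \<open>The density \<open>f\<^bsub>\<alpha>,\<theta>\<^esub>\<close>, where \<open>f\<close> is the density \<open>f\<^sub>\<alpha>\<close>.\<close>

definition tilted_stable_density ::
    "(real \<Rightarrow> real) \<Rightarrow> real \<Rightarrow> real \<Rightarrow> real \<Rightarrow> real" where
  "tilted_stable_density f \<alpha> \<theta> t =
     Gamma (\<theta> + 1) / Gamma (\<theta> / \<alpha> + 1) * t powr (- \<theta>) * f t"

definition gamma_law :: "real \<Rightarrow> real measure" where
  "gamma_law a = density lborel (\<lambda>x. ennreal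
     (if 0 < x then x powr (a - 1) * exp (- x) / Gamma a else 0))"

definition beta_law :: "real \<Rightarrow> real \<Rightarrow> real measure" where
  "beta_law a b = density lborel (\<lambda>x. ennreal
     (if 0 < x \<and> x < 1 then x powr (a - 1) * (1 - x) powr (b - 1) / Beta a b else 0))"

text \<open>
  The expectation of \<open>g (G * B powr \<alpha>)\<close> for independent \<open>G\<close> and \<open>B\<close> with laws
  gamma\<open>(a, 1)\<close> and beta\<open>(c, d)\<close>; independence is encoded by the product measure.
\<close>

definition E_gamma_beta ::
    "real \<Rightarrow> (real \<Rightarrow> real) \<Rightarrow> real \<Rightarrow> real \<Rightarrow> real \<Rightarrow> ennreal" where
  "E_gamma_beta \<alpha> g a c d =
     (\<integral>\<^sup>+p. ennreal (g (fst p * snd p powr \<alpha>)) \<partial>(gamma_law a \<Otimes>\<^sub>M beta_law c d))"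

definition Sigma_const :: "real \<Rightarrow> real \<Rightarrow> (real \<Rightarrow> real) \<Rightarrow> ennreal" where
  "Sigma_const \<alpha> \<theta> g = 1 / E_gamma_beta \<alpha> g (\<theta> / \<alpha> + 1) (\<theta> + \<alpha>) (1 - \<alpha>)"

text \<open>
  The mixing density \<open>\<gamma>\<^sub>\<alpha>\<close>. The inner expectation may be infinite for some \<open>t\<close>,
  hence the extended range.
\<close>

definition mixing_density ::
    "(real \<Rightarrow> real) \<Rightarrow> real \<Rightarrow> real \<Rightarrow> (real \<Rightarrow> real) \<Rightarrow> real \<Rightarrow> ennreal" where
  "mixing_density f \<alpha> \<theta> g t =
     Sigma_const \<alpha> \<theta> g
     * (\<integral>\<^sup>+x. ennreal (g (x powr \<alpha> / t powr \<alpha>)) \<partial>gamma_law (\<theta> + \<alpha>))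
     * ennreal (tilted_stable_density f \<alpha> \<theta> t)"

text \<open>
  The function \<open>\<bbbG>\<^sub>\<alpha>\<close> with indices \<open>n, k\<close>. The stable density \<open>f\<close> is positive almost
  everywhere on \<open>(0, \<infinity>)\<close>, so the convention \<open>x / 0 = 0\<close> does not affect integrals
  of this function.
\<close>

definition GG :: "(real \<Rightarrow> real) \<Rightarrow> real \<Rightarrow> nat \<Rightarrow> nat \<Rightarrow> real \<Rightarrow> ennreal" where
  "GG f \<alpha> n k t =
     ennreal (\<alpha> ^ k * t powr (- (real k * \<alpha>)) / (Gamma (real n - real k * \<alpha>) * f t))
     * (\<integral>\<^sup>+u\<in>{0<..<1}. ennreal (f (t * u) * (1 - u) powr (real n - real k * \<alpha> - 1)) \<partial>lborel)"

text \<open>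
  The weights \<open>V\<^bsub>n,k\<^esub>\<close> of the exchangeable partition probability function
  \<open>V\<^bsub>n,k\<^esub> \<Prod>\<^sub>j \<Gamma>(n\<^sub>j - \<alpha>) / \<Gamma>(1 - \<alpha>)\<close> of the Poisson-Kingman
  model with \<open>\<alpha>\<close>-stable density \<open>f\<close> and mixing density \<open>\<gamma>\<close>.
\<close>

definition PK_V :: "(real \<Rightarrow> real) \<Rightarrow> real \<Rightarrow> (real \<Rightarrow> ennreal) \<Rightarrow> nat \<Rightarrow> nat \<Rightarrow> ennreal" where
  "PK_V f \<alpha> \<gamma> n k = (\<integral>\<^sup>+t\<in>{0<..}. GG f \<alpha> n k t * \<gamma> t \<partial>lborel)"

end

theory Submission
  imports Defs
begin

text \<open>
  Two facts carry the proof. Write \<open>a = \<theta> + \<alpha>\<close>, \<open>b = \<theta> + k \<alpha>\<close>,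
  \<open>c = n - k \<alpha>\<close>, \<open>d = n - \<alpha>\<close>; these are related by \<open>a + d = b + c\<close>.

  Once the density \<open>f\<close> in the denominator of \<open>GG\<close> has been cancelled against the one in
  the mixing density, \<open>V\<^bsub>n,k\<^esub>\<close> is a constant times the expectation of
  \<open>g ((G\<^sub>a B\<^bsub>b,c\<^esub> / T)\<^sup>\<alpha>)\<close>, where \<open>T\<close> has a density proportional to
  \<open>t\<^bsup>-b\<^esup> f(t)\<close>. The claim is that the law of \<open>G\<^sub>a B\<^bsub>b,c\<^esub> / T\<close> is that of
  \<open>G\<^sup>1\<^sup>/\<^sup>\<alpha> B\<^bsub>a,d\<^esub>\<close> with \<open>G\<close> of law gamma\<open>(b / \<alpha>, 1)\<close>. Both laws turn
  out to have density proportional to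
  \<open>y\<^bsup>a-1\<^esup> \<integral>\<^bsub>0\<^esub>\<^bsup>\<infinity>\<^esup> z\<^bsup>d-1\<^esup> (y + z)\<^bsup>-c\<^esup> exp (- (y + z)\<^sup>\<alpha>) dz\<close>.
  For the second law this is the change of variables from the pair \<open>(q, v)\<close>,
  with \<open>q\<^sup>\<alpha>\<close> the gamma and \<open>v\<close> the beta variable, to \<open>y = q v\<close>,
  \<open>z = q (1 - v)\<close> (\<open>gamma_beta_mixture\<close>). For the first, an auxiliary gamma integral over
  \<open>z\<close> decouples the variables, and \<open>exp (- (y + z)\<^sup>\<alpha>)\<close> arises as the Laplace
  transform of \<open>f\<close> at \<open>y + z\<close> (\<open>stable_residual_integral\<close>,
  \<open>stable_gamma_mixture\<close>). All integrands are nonnegative, so Tonelli's theorem justifies every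
  exchange of integrals.

  The cancellation of \<open>f\<close> requires that \<open>f > 0\<close> almost everywhere
  (\<open>stable_density_positive\<close>), which has to be extracted from the Laplace transform. Uniqueness of
  Laplace transforms (\<open>laplace_transform_unique\<close>) shows that \<open>t f(t)\<close> is a multiple of the
  convolution of \<open>f\<close> with \<open>r\<^bsup>-\<alpha>\<^esup>\<close>. So \<open>f\<close> can vanish at \<open>t\<close> only if it vanishes
  almost everywhere before \<open>t\<close>, and that is excluded by the slow decay of
  \<open>exp (- s\<^sup>\<alpha>)\<close>.
\<close>

section \<open>Changes of variables on the half-line\<close>

lemma set_nn_integral_eqI:
  assumes "\<And>x. x \<in> A \<Longrightarrow> f x = h x"
  shows "set_nn_integral M A f = set_nn_integral M A h"
  by (intro set_nn_integral_cong refl) (use assms in auto)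

lemma measurable_curried_compose:
  fixes H :: "real \<Rightarrow> real \<Rightarrow> ennreal"
  assumes [measurable]: "case_prod H \<in> borel_measurable (borel \<Otimes>\<^sub>M borel)"
    and [measurable]: "u \<in> borel_measurable M" "v \<in> borel_measurable M"
  shows "(\<lambda>x. H (u x) (v x)) \<in> borel_measurable M"
  using measurable_compose[of "\<lambda>x. (u x, v x)" M "borel \<Otimes>\<^sub>M borel" "case_prod H"] by simp

lemma set_nn_integral_swap:
  fixes H :: "real \<Rightarrow> real \<Rightarrow> ennreal"
  assumes [measurable]: "case_prod H \<in> borel_measurable (borel \<Otimes>\<^sub>M borel)" "A \<in> sets borel" "B \<in> sets borel"
  shows "(\<integral>\<^sup>+x\<in>A. (\<integral>\<^sup>+y\<in>B. H x y \<partial>lborel) \<partial>lborel) = (\<integral>\<^sup>+y\<in>B. (\<integral>\<^sup>+x\<in>A. H x y \<partial>lborel) \<partial>lborel)"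
proof -
  note [measurable (raw)] = measurable_curried_compose[OF assms(1)]
  have "(\<integral>\<^sup>+x\<in>A. (\<integral>\<^sup>+y\<in>B. H x y \<partial>lborel) \<partial>lborel)
      = (\<integral>\<^sup>+x. \<integral>\<^sup>+y. H x y * indicator B y * indicator A x \<partial>lborel \<partial>lborel)"
    by (subst nn_integral_multc) auto
  also have "\<dots> = (\<integral>\<^sup>+y. \<integral>\<^sup>+x. H x y * indicator B y * indicator A x \<partial>lborel \<partial>lborel)"
    by (rule lborel_pair.Fubini') (auto simp: split_beta)
  also have "\<dots> = (\<integral>\<^sup>+y. \<integral>\<^sup>+x. H x y * indicator A x * indicator B y \<partial>lborel \<partial>lborel)"
    by (simp add: mult_ac)
  also have "\<dots> = (\<integral>\<^sup>+y\<in>B. (\<integral>\<^sup>+x\<in>A. H x y \<partial>lborel) \<partial>lborel)"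
    by (subst nn_integral_multc) auto
  finally show ?thesis .
qed

lemma set_nn_integral_mult_left:
  assumes [measurable]: "h \<in> borel_measurable borel" "A \<in> sets borel"
  shows "(\<integral>\<^sup>+x\<in>A. c * h x \<partial>lborel) = c * (\<integral>\<^sup>+x\<in>A. h x \<partial>lborel)"
  by (simp add: mult.assoc nn_integral_cmult)

lemma nn_integral_Ioi_scale:
  fixes h :: "real \<Rightarrow> ennreal"
  assumes [measurable]: "h \<in> borel_measurable borel" and c: "0 < c"
  shows "(\<integral>\<^sup>+x\<in>{0<..}. h x \<partial>lborel) = (\<integral>\<^sup>+y\<in>{0<..}. ennreal c * h (c * y) \<partial>lborel)"
proof -
  have "(\<integral>\<^sup>+x\<in>{0<..}. h x \<partial>lborel)
      = ennreal c * (\<integral>\<^sup>+y. h (0 + c * y) * indicator {0<..} (0 + c * y) \<partial>lborel)"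
    using c by (subst nn_integral_real_affine[of _ c 0]) auto
  also have "\<dots> = (\<integral>\<^sup>+y\<in>{0<..}. ennreal c * h (c * y) \<partial>lborel)"
    using c by (subst nn_integral_cmult[symmetric])
      (auto intro!: nn_integral_cong simp: mult.assoc zero_less_mult_iff split: split_indicator)
  finally show ?thesis .
qed

text \<open>
  The coordinates \<open>t = s + r\<close> and \<open>u = s / (s + r)\<close> on the quadrant have Jacobian \<open>t\<close>.
  They separate a gamma total from a beta fraction, and both sides of the final identity are brought
  to a common form by them. At fixed \<open>t\<close> the substitution \<open>s = t u\<close> is a scaling,
  and after exchanging the integrals \<open>r = t - s\<close> is a translation, so the affine change of
  variables on the line is enough.
\<close>

lemma nn_integral_polar:
  fixes H :: "real \<Rightarrow> real \<Rightarrow> ennreal"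
  assumes [measurable]: "case_prod H \<in> borel_measurable (borel \<Otimes>\<^sub>M borel)"
  shows "(\<integral>\<^sup>+t\<in>{0<..}. (\<integral>\<^sup>+u\<in>{0<..<1}. ennreal t * H (t * u) (t * (1 - u)) \<partial>lborel) \<partial>lborel)
       = (\<integral>\<^sup>+s\<in>{0<..}. (\<integral>\<^sup>+r\<in>{0<..}. H s r \<partial>lborel) \<partial>lborel)"
proof -
  note [measurable (raw)] = measurable_curried_compose[OF assms]
  have inner: "(\<integral>\<^sup>+u\<in>{0<..<1}. ennreal t * H (t * u) (t * (1 - u)) \<partial>lborel)
      = (\<integral>\<^sup>+s\<in>{0<..}. H s (t - s) * indicator {0<..} (t - s) \<partial>lborel)" if t: "0 < t" for t
  proof -
    have "(\<integral>\<^sup>+s\<in>{0<..}. H s (t - s) * indicator {0<..} (t - s) \<partial>lborel)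
      = ennreal t * (\<integral>\<^sup>+u. H (0 + t * u) (t - (0 + t * u)) * indicator {0<..} (t - (0 + t * u))
            * indicator {0<..} (0 + t * u) \<partial>lborel)"
      using t by (subst nn_integral_real_affine[of _ t 0]) auto
    also have "\<dots> = (\<integral>\<^sup>+u. ennreal t * (H (0 + t * u) (t - (0 + t * u)) * indicator {0<..} (t - (0 + t * u))
            * indicator {0<..} (0 + t * u)) \<partial>lborel)"
      by (rule nn_integral_cmult[symmetric]) auto
    also have "\<dots> = (\<integral>\<^sup>+u\<in>{0<..<1}. ennreal t * H (t * u) (t * (1 - u)) \<partial>lborel)"
      using t by (auto intro!: nn_integral_cong simp: algebra_simps zero_less_mult_iff split: split_indicator)
    finally show ?thesis ..
  qed
  have shift: "(\<integral>\<^sup>+t\<in>{0<..}. H s (t - s) * indicator {0<..} (t - s) \<partial>lborel)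
      = (\<integral>\<^sup>+r\<in>{0<..}. H s r \<partial>lborel)" if s: "0 < s" for s
  proof -
    have "(\<integral>\<^sup>+t\<in>{0<..}. H s (t - s) * indicator {0<..} (t - s) \<partial>lborel)
       = (\<integral>\<^sup>+r. H s (s + 1 * r - s) * indicator {0<..} (s + 1 * r - s) * indicator {0<..} (s + 1 * r) \<partial>lborel)"
      by (subst nn_integral_real_affine[of _ 1 s]) auto
    also have "\<dots> = (\<integral>\<^sup>+r\<in>{0<..}. H s r \<partial>lborel)"
      using s by (auto intro!: nn_integral_cong split: split_indicator)
    finally show ?thesis .
  qed
  have "(\<integral>\<^sup>+t\<in>{0<..}. (\<integral>\<^sup>+u\<in>{0<..<1}. ennreal t * H (t * u) (t * (1 - u)) \<partial>lborel) \<partial>lborel)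
      = (\<integral>\<^sup>+t\<in>{0<..}. (\<integral>\<^sup>+s\<in>{0<..}. H s (t - s) * indicator {0<..} (t - s) \<partial>lborel) \<partial>lborel)"
    by (intro set_nn_integral_eqI inner) auto
  also have "\<dots> = (\<integral>\<^sup>+s\<in>{0<..}. (\<integral>\<^sup>+t\<in>{0<..}. H s (t - s) * indicator {0<..} (t - s) \<partial>lborel) \<partial>lborel)"
    by (rule set_nn_integral_swap) (auto simp: split_beta)
  also have "\<dots> = (\<integral>\<^sup>+s\<in>{0<..}. (\<integral>\<^sup>+r\<in>{0<..}. H s r \<partial>lborel) \<partial>lborel)"
    by (intro set_nn_integral_eqI shift) auto
  finally show ?thesis .
qed

lemma nn_integral_Gamma:
  fixes a p :: real
  assumes a: "0 < a" and p: "0 < p"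
  shows "(\<integral>\<^sup>+r\<in>{0<..}. ennreal (r powr (a - 1) * exp (- (r * p))) \<partial>lborel)
       = ennreal (Gamma a * p powr (- a))"
proof -
  have "ennreal (Gamma a) = (\<integral>\<^sup>+x\<in>{0<..}. ennreal (x powr (a - 1) * exp (- x)) \<partial>lborel)"
    by (subst Gamma_conv_nn_integral_real[OF a])
      (auto intro!: nn_integral_cong simp: exp_minus divide_inverse split: split_indicator)
  also have "\<dots> = (\<integral>\<^sup>+y\<in>{0<..}. ennreal p * ennreal ((p * y) powr (a - 1) * exp (- (p * y))) \<partial>lborel)"
    using p by (subst nn_integral_Ioi_scale[of _ p]) auto
  also have "\<dots> = (\<integral>\<^sup>+y\<in>{0<..}. ennreal (p powr a) * ennreal (y powr (a - 1) * exp (- (y * p))) \<partial>lborel)"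
  proof (rule set_nn_integral_eqI)
    fix y :: real assume "y \<in> {0<..}"
    then have "p * ((p * y) powr (a - 1) * exp (- (p * y))) = p powr a * (y powr (a - 1) * exp (- (y * p)))"
      using p by (simp add: powr_mult powr_diff field_simps)
    then show "ennreal p * ennreal ((p * y) powr (a - 1) * exp (- (p * y)))
        = ennreal (p powr a) * ennreal (y powr (a - 1) * exp (- (y * p)))"
      using p by (simp add: ennreal_mult[symmetric])
  qed
  also have "\<dots> = ennreal (p powr a) * (\<integral>\<^sup>+y\<in>{0<..}. ennreal (y powr (a - 1) * exp (- (y * p))) \<partial>lborel)"
    by (rule set_nn_integral_mult_left) auto
  finally have *: "ennreal (p powr a) * (\<integral>\<^sup>+y\<in>{0<..}. ennreal (y powr (a - 1) * exp (- (y * p))) \<partial>lborel) = ennreal (Gamma a)"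
    (is "_ * ?I = _") ..
  have "?I = ennreal (p powr (- a)) * (ennreal (p powr a) * ?I)"
    using p by (simp add: mult.assoc[symmetric] ennreal_mult[symmetric] powr_minus)
  also have "\<dots> = ennreal (Gamma a * p powr (- a))"
    unfolding * using Gamma_real_pos[OF a] by (simp add: ennreal_mult[symmetric] mult.commute)
  finally show ?thesis .
qed

lemma nn_integral_power_substitution:
  fixes h :: "real \<Rightarrow> ennreal"
  assumes [measurable]: "h \<in> borel_measurable borel" and \<alpha>: "0 < \<alpha>"
  shows "(\<integral>\<^sup>+x\<in>{0<..}. h x \<partial>lborel)
       = (\<integral>\<^sup>+q\<in>{0<..}. ennreal (\<alpha> * q powr (\<alpha> - 1)) * h (q powr \<alpha>) \<partial>lborel)"
proof -
  \<comment> \<open>The substitution rule for compact intervals is applied to \<open>A n\<close>, whose image is \<open>B n\<close>; both exhaust the half-line.\<close>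
  define A :: "nat \<Rightarrow> real set" where "A n = {1 / (real n + 2) .. real n + 2}" for n
  define B :: "nat \<Rightarrow> real set" where "B n = {(1 / (real n + 2)) powr \<alpha> .. (real n + 2) powr \<alpha>}" for n
  have fin: "(\<integral>\<^sup>+x. h x * indicator (B n) x \<partial>lborel)
      = (\<integral>\<^sup>+q. ennreal (\<alpha> * q powr (\<alpha> - 1)) * h (q powr \<alpha>) * indicator (A n) q \<partial>lborel)" for n
  proof -
    have pos: "0 < 1 / (real n + 2)" by simp
    have lt: "1 / (real n + 2) < real n + 2" 
      by (rule less_le_trans[of _ 1]) auto
    have "(\<integral>\<^sup>+x. h x * indicator (B n) x \<partial>lborel)
      = (\<integral>\<^sup>+q. h (q powr \<alpha>) * ennreal (\<alpha> * q powr (\<alpha> - 1)) * indicator (A n) q \<partial>lborel)"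
      unfolding A_def B_def
      by (rule nn_integral_substitution_aux[OF _ _ _ _ _ lt])
        (use \<alpha> pos in \<open>auto intro!: derivative_eq_intros continuous_intros dest: less_le_trans[OF pos]\<close>)
    then show ?thesis by (simp add: mult.commute)
  qed
  have SA: "(\<Union>n. A n) = {0<..}" and SB: "(\<Union>n. B n) = {0<..}"
  proof -
    show SA: "(\<Union>n. A n) = {0<..}"
    proof (intro set_eqI iffI)
      fix x :: real assume "x \<in> {0<..}"
      then have x: "0 < x" by simp
      obtain n where n: "max x (1 / x) < real n" using reals_Archimedean2 by blast
      then have "1 / x \<le> real n + 2" by simp
      then have "1 / (real n + 2) \<le> x" using x by (simp add: field_simps)
      with n show "x \<in> (\<Union>n. A n)" by (auto simp: A_def intro!: exI[of _ n])
    next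
      fix x :: real assume "x \<in> (\<Union>n. A n)"
      then show "x \<in> {0<..}" by (auto simp: A_def elim!: less_le_trans[rotated])
    qed
    show "(\<Union>n. B n) = {0<..}"
    proof (intro set_eqI iffI)
      fix x :: real assume "x \<in> {0<..}"
      then have x: "0 < x" by simp
      then have "x powr (1 / \<alpha>) \<in> (\<Union>n. A n)" using SA by simp
      then obtain n where "1 / (real n + 2) \<le> x powr (1 / \<alpha>)" "x powr (1 / \<alpha>) \<le> real n + 2" by (auto simp: A_def)
      then have "(1 / (real n + 2)) powr \<alpha> \<le> (x powr (1 / \<alpha>)) powr \<alpha>"
         "(x powr (1 / \<alpha>)) powr \<alpha> \<le> (real n + 2) powr \<alpha>"
        using \<alpha> by (auto intro!: powr_mono2)
      then show "x \<in> (\<Union>n. B n)" using x \<alpha> by (auto simp: B_def powr_powr intro!: exI[of _ n])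
    next
      fix x :: real assume "x \<in> (\<Union>n. B n)"
      then obtain n where "(1 / (real n + 2)) powr \<alpha> \<le> x" by (auto simp: B_def)
      moreover have "0 < (1 / (real n + 2)) powr \<alpha>" by simp
      ultimately show "x \<in> {0<..}" by (auto intro: less_le_trans simp del: powr_gt_zero)
    qed
  qed
  have step: "1 / (real (Suc n) + 2) \<le> 1 / (real n + 2)" for n by (simp add: frac_le)
  have IA: "incseq A"
    unfolding A_def by (rule incseq_SucI) (intro atLeastatMost_subset_iff[THEN iffD2] disjI2 conjI step, simp)
  have IB: "incseq B"
    unfolding B_def
    by (rule incseq_SucI) (use \<alpha> step in \<open>intro atLeastatMost_subset_iff[THEN iffD2] disjI2 conjI powr_mono2; simp\<close>)
  have lim: "(\<integral>\<^sup>+x. k x * indicator {0<..} x \<partial>lborel) = (SUP n. \<integral>\<^sup>+x. k x * indicator (C n) x \<partial>lborel)"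
    if C: "incseq C" "(\<Union>n. C n) = {0<..}" "\<And>n. C n \<in> sets borel" and [measurable]: "k \<in> borel_measurable borel"
    for C :: "nat \<Rightarrow> real set" and k :: "real \<Rightarrow> ennreal"
  proof -
    have [measurable]: "C n \<in> sets borel" for n by fact
    have "emeasure (density lborel k) (\<Union>n. C n) = (SUP n. emeasure (density lborel k) (C n))"
      by (rule SUP_emeasure_incseq[symmetric]) (use C in auto)
    then show ?thesis by (simp add: C(2) emeasure_density)
  qed
  have "(\<integral>\<^sup>+x\<in>{0<..}. h x \<partial>lborel) = (SUP n. \<integral>\<^sup>+x. h x * indicator (B n) x \<partial>lborel)"
    by (rule lim[OF IB SB]) (auto simp: B_def)
  also have "\<dots> = (\<integral>\<^sup>+q\<in>{0<..}. ennreal (\<alpha> * q powr (\<alpha> - 1)) * h (q powr \<alpha>) \<partial>lborel)"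
    unfolding fin by (rule lim[OF IA SA, symmetric]) (auto simp: A_def)
  finally show ?thesis .
qed

section \<open>Uniqueness of Laplace transforms\<close>

lemma exp_multiple_tendsto_0:
  fixes d :: real
  assumes "0 < d"
  shows "(\<lambda>n. exp (- (real n * d))) \<longlonglongrightarrow> 0"
proof -
  have "(\<lambda>n. exp (- d) ^ n) \<longlonglongrightarrow> 0"
    by (rule LIMSEQ_realpow_zero) (use assms in auto)
  then show ?thesis by (simp add: exp_of_nat_mult[symmetric])
qed

text \<open>
  An explicit polynomial approximation, in the variable \<open>x = exp (- t)\<close>, of the indicator of
  \<open>t > y\<close>. With \<open>m\<close> about \<open>exp (n y)\<close> the number
  \<open>(1 - x ^ n) ^ m\<close> behaves like \<open>exp (- exp (n (y - t)))\<close>, a double exponential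
  with a sharp threshold at \<open>t = y\<close>: Bernoulli's inequality handles \<open>t > y\<close> and
  \<open>1 - x \<le> exp (- x)\<close> handles \<open>t < y\<close>.
\<close>

lemma threshold_tendsto:
  fixes y t :: real
  assumes t: "0 < t" and ne: "t \<noteq> y"
  shows "(\<lambda>n. (1 - exp (- t) ^ n) ^ nat \<lceil>exp (real n * y)\<rceil>) \<longlonglongrightarrow> indicator {y<..} t"
proof -
  define m where "m n = nat \<lceil>exp (real n * y)\<rceil>" for n :: nat
  define x where "x n = exp (- t) ^ n" for n :: nat
  have x: "x n = exp (- (real n * t))" for n by (simp add: x_def exp_of_nat_mult[symmetric])
  have x01: "0 < x n" "x n \<le> 1" for n using t by (auto simp: x)
  have m_ge: "exp (real n * y) \<le> real (m n)" for n
    unfolding m_def by (rule real_nat_ceiling_ge)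
  have m_le: "real (m n) \<le> exp (real n * y) + 1" for n
  proof -
    have "real (m n) = of_int \<lceil>exp (real n * y)\<rceil>"
      unfolding m_def by (simp add: order_trans[OF _ le_of_int_ceiling])
    then show ?thesis by linarith
  qed
  show ?thesis
  proof (cases "y < t")
    case True
    have upper: "real (m n) * x n \<le> exp (- (real n * (t - y))) + exp (- (real n * t))" for n
    proof -
      have "real (m n) * x n \<le> (exp (real n * y) + 1) * x n"
        by (rule mult_right_mono) (use m_le[of n] x01[of n] in auto)
      also have "\<dots> = exp (- (real n * (t - y))) + exp (- (real n * t))"
        by (simp add: x algebra_simps exp_add[symmetric])
      finally show ?thesis .
    qed
    have "(\<lambda>n. 1 - (exp (- (real n * (t - y))) + exp (- (real n * t)))) \<longlonglongrightarrow> 1 - (0 + 0)"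
      by (intro tendsto_intros exp_multiple_tendsto_0) (use t True in auto)
    then have lim: "(\<lambda>n. 1 - (exp (- (real n * (t - y))) + exp (- (real n * t)))) \<longlonglongrightarrow> 1" by simp
    have "(\<lambda>n. (1 - x n) ^ m n) \<longlonglongrightarrow> 1"
    proof (rule tendsto_sandwich[OF _ _ lim tendsto_const])
      have "1 - real (m n) * x n \<le> (1 - x n) ^ m n" for n
        using Bernoulli_inequality[of "- x n" "m n"] x01[of n] by simp
      then show "\<forall>\<^sub>F n in sequentially. 1 - (exp (- (real n * (t - y))) + exp (- (real n * t))) \<le> (1 - x n) ^ m n"
        using upper by (intro always_eventually allI) (smt (verit))
      show "\<forall>\<^sub>F n in sequentially. (1 - x n) ^ m n \<le> 1"
        using x01 by (intro always_eventually allI power_le_one) (auto simp: less_imp_le)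
    qed
    then show ?thesis using True by (simp add: x_def m_def)
  next
    case False
    with ne have ty: "t < y" by simp
    have "(\<lambda>n. (1 - x n) ^ m n) \<longlonglongrightarrow> 0"
    proof (rule tendsto_sandwich[OF _ _ tendsto_const exp_multiple_tendsto_0[of "y - t"]])
      show "0 < y - t" using ty by simp
      show "\<forall>\<^sub>F n in sequentially. 0 \<le> (1 - x n) ^ m n"
        using x01 by (intro always_eventually allI zero_le_power) auto
      have "(1 - x n) ^ m n \<le> exp (- (real n * (y - t)))" for n
      proof -
        have "(1 - x n) ^ m n \<le> exp (- x n) ^ m n"
          using x01[of n] exp_ge_add_one_self[of "- x n"] by (intro power_mono) auto
        also have "\<dots> = exp (- (real (m n) * x n))" by (simp add: exp_of_nat_mult[symmetric])
        also have "\<dots> \<le> exp (- exp (real n * (y - t)))"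
        proof -
          have "exp (real n * (y - t)) = exp (real n * y) * x n"
            by (simp add: x algebra_simps exp_add[symmetric])
          also have "\<dots> \<le> real (m n) * x n"
            by (rule mult_right_mono) (use m_ge[of n] x01[of n] in auto)
          finally show ?thesis by simp
        qed
        finally have le: "(1 - x n) ^ m n \<le> exp (- exp (real n * (y - t)))" .
        have "real n * (y - t) \<le> exp (real n * (y - t))"
          using exp_ge_add_one_self[of "real n * (y - t)"] by linarith
        then have "exp (- exp (real n * (y - t))) \<le> exp (- (real n * (y - t)))" by simp
        with le show ?thesis by (rule order_trans)
      qed
      then show "\<forall>\<^sub>F n in sequentially. (1 - x n) ^ m n \<le> exp (- (real n * (y - t)))" by simp
    qed
    then show ?thesis using False by (simp add: x_def m_def)
  qed
qed

text \<open>
  The Laplace transform at the integers integrates every polynomial in \<open>exp (- t)\<close>. The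
  polynomials of \<open>threshold_tendsto\<close> stay in \<open>[0, 1]\<close>, so by dominated convergence the transform
  determines the mass of every half-line \<open>{y<..}\<close>, hence the measure, hence its density up to a
  null set. The one point at which the polynomials have another limit is harmless for an absolutely
  continuous measure.
\<close>

lemma laplace_transform_unique:
  fixes f k :: "real \<Rightarrow> ennreal"
  assumes f [measurable]: "f \<in> borel_measurable borel" and k [measurable]: "k \<in> borel_measurable borel"
    and laplace: "\<And>n::nat. (\<integral>\<^sup>+t\<in>{0<..}. ennreal (exp (- (real n * t))) * f t \<partial>lborel)
                    = (\<integral>\<^sup>+t\<in>{0<..}. ennreal (exp (- (real n * t))) * k t \<partial>lborel)"
    and finite: "(\<integral>\<^sup>+t\<in>{0<..}. f t \<partial>lborel) < \<infinity>"
  shows "AE t in lborel. 0 < t \<longrightarrow> f t = k t"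
proof -
  define M where "M = density lborel (\<lambda>t. f t * indicator {0<..} t)"
  define N where "N = density lborel (\<lambda>t. k t * indicator {0<..} t)"
  have sets [measurable_cong, simp]: "sets M = sets borel" "sets N = sets borel"
    by (simp_all add: M_def N_def)
  have fin_k: "(\<integral>\<^sup>+t\<in>{0<..}. k t \<partial>lborel) < \<infinity>"
    using finite laplace[of 0] by simp
  have space: "space M = UNIV" "space N = UNIV" by (simp_all add: M_def N_def)
  interpret M: finite_measure M
    by (rule finite_measureI) (use finite in \<open>simp add: M_def emeasure_density\<close>)
  interpret N: finite_measure N
    by (rule finite_measureI) (use fin_k in \<open>simp add: N_def emeasure_density\<close>)
  have AE_pos: "AE t in M. 0 < t" "AE t in N. 0 < t"
    unfolding M_def N_def by (subst AE_density; auto split: split_indicator_asm)+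
  have AE_ne: "AE t in M. t \<noteq> y" "AE t in N. t \<noteq> y" for y
    unfolding M_def N_def using AE_lborel_singleton[of y] by (subst AE_density; auto)+
  have pow_bound: "norm (exp (- t) ^ i * (1 - exp (- t) ^ n) ^ m) \<le> 1" if "0 < t" for i n m :: nat and t :: real
  proof -
    have "exp (- t) ^ n \<le> 1" using that by (intro power_le_one) auto
    then show ?thesis using that by (auto simp: abs_mult power_abs intro!: mult_le_one power_le_one)
  qed
  have pow_int: "integrable M (\<lambda>t. exp (- t) ^ i * (1 - exp (- t) ^ n) ^ m)"
      "integrable N (\<lambda>t. exp (- t) ^ i * (1 - exp (- t) ^ n) ^ m)" for i n m :: nat
    using AE_pos pow_bound
    by (auto intro!: M.integrable_const_bound[where B = 1] N.integrable_const_bound[where B = 1]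
        elim!: eventually_mono simp del: real_norm_def)
  have pow_eq: "(\<integral>t. exp (- t) ^ i * (1 - exp (- t) ^ n) ^ m \<partial>M) = (\<integral>t. exp (- t) ^ i * (1 - exp (- t) ^ n) ^ m \<partial>N)"
    for i n m :: nat
  proof (induction m arbitrary: i)
    case 0
    have "(\<integral>\<^sup>+t. ennreal (exp (- t) ^ i) \<partial>M) = (\<integral>\<^sup>+t. ennreal (exp (- t) ^ i) \<partial>N)"
      using laplace[of i]
      by (simp add: M_def N_def nn_integral_density exp_of_nat_mult[symmetric] mult_ac)
    then show ?case by (simp add: integral_eq_nn_integral)
  next
    case (Suc m)
    \<comment> \<open>The extra factor \<open>exp (- t) ^ i\<close> absorbs the power of \<open>exp (- t)\<close> that appears when one factor is expanded.\<close>
    have split: "exp (- t) ^ i * (1 - exp (- t) ^ n) ^ Suc m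
        = exp (- t) ^ i * (1 - exp (- t) ^ n) ^ m - exp (- t) ^ (i + n) * (1 - exp (- t) ^ n) ^ m" for t :: real
      by (simp add: power_add algebra_simps)
    show ?case
      unfolding split by (simp add: Bochner_Integration.integral_diff pow_int Suc del: power_Suc)
  qed
  have tail: "emeasure M {y<..} = emeasure N {y<..}" for y
  proof -
    define \<phi> where "\<phi> n t = (1 - exp (- t) ^ n) ^ nat \<lceil>exp (real n * y)\<rceil>" for n and t :: real
    have lim: "(\<lambda>n. integral\<^sup>L Q (\<phi> n)) \<longlonglongrightarrow> measure Q {y<..}"
      if Q: "finite_measure Q" "sets Q = sets borel" "AE t in Q. 0 < t" "AE t in Q. t \<noteq> y" for Q
    proof -
      interpret Q: finite_measure Q by fact
      note [measurable_cong] = Q(2)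
      have "(\<lambda>n. integral\<^sup>L Q (\<phi> n)) \<longlonglongrightarrow> integral\<^sup>L Q (indicator {y<..})"
      proof (rule integral_dominated_convergence[where w = "\<lambda>_. 1"])
        show "AE t in Q. (\<lambda>n. \<phi> n t) \<longlonglongrightarrow> indicator {y<..} t"
          using Q(3,4) by eventually_elim (simp add: \<phi>_def threshold_tendsto)
        show "AE t in Q. norm (\<phi> n t) \<le> 1" for n
          using Q(3) by eventually_elim (use pow_bound[of _ 0] in \<open>simp add: \<phi>_def\<close>)
      qed (auto simp: \<phi>_def[abs_def])
      then show ?thesis using sets_eq_imp_space_eq[OF Q(2)] by simp
    qed
    have "(\<lambda>n. integral\<^sup>L M (\<phi> n)) \<longlonglongrightarrow> measure N {y<..}"
      using lim[of N] AE_pos AE_ne N.finite_measure_axioms pow_eq[of 0]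
      unfolding \<phi>_def by simp
    moreover have "(\<lambda>n. integral\<^sup>L M (\<phi> n)) \<longlonglongrightarrow> measure M {y<..}"
      using lim[of M] AE_pos AE_ne M.finite_measure_axioms by simp
    ultimately have "measure M {y<..} = measure N {y<..}" by (rule LIMSEQ_unique[rotated])
    then show ?thesis by (simp add: M.emeasure_eq_measure N.emeasure_eq_measure)
  qed
  have "M = N"
    by (rule measure_eqI_lessThan) (auto simp: tail N.emeasure_eq_measure)
  then have "AE t in lborel. f t * indicator {0<..} t = k t * indicator {0<..} t"
    by (intro sigma_finite_measure.density_unique[OF lborel.sigma_finite_measure_axioms]) (auto simp: M_def N_def)
  then show ?thesis by eventually_elim (auto split: split_indicator_asm)
qed

section \<open>Positivity of the stable density\<close>

text \<open>
  The stable density solves \<open>t f(t) = \<alpha> / \<Gamma>(1 - \<alpha>) \<integral>\<^bsub>0\<^esub>\<^bsup>t\<^esup> f(s) (t - s)\<^bsup>-\<alpha>\<^esup> ds\<close>.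
  On Laplace transforms this says \<open>- (exp (- s powr \<alpha>))' = \<alpha> s powr (\<alpha> - 1) exp (- s powr \<alpha>)\<close>,
  since \<open>\<Gamma>(1 - \<alpha>) s powr (\<alpha> - 1)\<close> is the transform of \<open>r powr (- \<alpha>)\<close>.
  The derivative is avoided by dividing by \<open>t\<close>, which integrates transforms:
  \<open>exp (- s t) / t\<close> is the integral of \<open>exp (- p t)\<close> over \<open>p > s\<close>. Both
  sides then have transform \<open>exp (- s powr \<alpha>)\<close>, and uniqueness applies.
\<close>

lemma stable_density_integral_equation:
  fixes f :: "real \<Rightarrow> ennreal"
  assumes f [measurable]: "f \<in> borel_measurable borel" and \<alpha>: "0 < \<alpha>" "\<alpha> < 1"
    and laplace: "\<And>s. 0 \<le> s \<Longrightarrow>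
      (\<integral>\<^sup>+t\<in>{0<..}. ennreal (exp (- (s * t))) * f t \<partial>lborel) = ennreal (exp (- (s powr \<alpha>)))"
  shows "AE t in lborel. 0 < t \<longrightarrow> f t = ennreal (\<alpha> / Gamma (1 - \<alpha>) / t)
           * (\<integral>\<^sup>+s\<in>{0<..}. f s * ennreal ((t - s) powr (- \<alpha>)) * indicator {0<..} (t - s) \<partial>lborel)"
proof -
  define c where "c = \<alpha> / Gamma (1 - \<alpha>)"
  have G: "0 < Gamma (1 - \<alpha>)" using \<alpha> by (intro Gamma_real_pos) simp
  then have c: "0 < c" using \<alpha> by (simp add: c_def)
  define k where "k t = (\<integral>\<^sup>+s\<in>{0<..}. f s * ennreal ((t - s) powr (- \<alpha>)) * indicator {0<..} (t - s) \<partial>lborel)" for t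
  have k_meas [measurable]: "k \<in> borel_measurable borel" unfolding k_def by measurable
  \<comment> \<open>The transform of the convolution \<open>k\<close> is the product of the two transforms; \<open>t = s + r\<close>.\<close>
  have conv: "(\<integral>\<^sup>+t\<in>{0<..}. ennreal (exp (- (p * t))) * k t \<partial>lborel)
      = ennreal (Gamma (1 - \<alpha>) * (p powr (\<alpha> - 1) * exp (- (p powr \<alpha>))))" if p: "0 < p" for p
  proof -
    have "(\<integral>\<^sup>+t\<in>{0<..}. ennreal (exp (- (p * t))) * k t \<partial>lborel)
      = (\<integral>\<^sup>+t\<in>{0<..}. (\<integral>\<^sup>+s\<in>{0<..}. ennreal (exp (- (p * t))) *
          (f s * ennreal ((t - s) powr (- \<alpha>)) * indicator {0<..} (t - s)) \<partial>lborel) \<partial>lborel)"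
      unfolding k_def by (intro set_nn_integral_eqI set_nn_integral_mult_left[symmetric]) auto
    also have "\<dots> = (\<integral>\<^sup>+s\<in>{0<..}. (\<integral>\<^sup>+t\<in>{0<..}. ennreal (exp (- (p * t))) *
          (f s * ennreal ((t - s) powr (- \<alpha>)) * indicator {0<..} (t - s)) \<partial>lborel) \<partial>lborel)"
      by (rule set_nn_integral_swap) auto
    also have "\<dots> = (\<integral>\<^sup>+s\<in>{0<..}. ennreal (Gamma (1 - \<alpha>) * p powr (\<alpha> - 1)) *
         (ennreal (exp (- (p * s))) * f s) \<partial>lborel)"
    proof (rule set_nn_integral_eqI)
      fix s :: real assume "s \<in> {0<..}"
      then have s: "0 < s" by simp
      have "(\<integral>\<^sup>+t\<in>{0<..}. ennreal (exp (- (p * t))) *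
          (f s * ennreal ((t - s) powr (- \<alpha>)) * indicator {0<..} (t - s)) \<partial>lborel)
        = (\<integral>\<^sup>+r. ennreal (exp (- (p * (s + 1 * r)))) *
          (f s * ennreal ((s + 1 * r - s) powr (- \<alpha>)) * indicator {0<..} (s + 1 * r - s)) * indicator {0<..} (s + 1 * r) \<partial>lborel)"
        by (subst nn_integral_real_affine[of _ 1 s]) auto
      also have "\<dots> = (\<integral>\<^sup>+r\<in>{0<..}. (ennreal (exp (- (p * s))) * f s) *
           ennreal (r powr ((1 - \<alpha>) - 1) * exp (- (r * p))) \<partial>lborel)"
        using s by (auto intro!: nn_integral_cong split: split_indicator simp: ennreal_mult algebra_simps exp_add exp_diff exp_minus divide_inverse)
      also have "\<dots> = (ennreal (exp (- (p * s))) * f s) * ennreal (Gamma (1 - \<alpha>) * p powr (- (1 - \<alpha>)))"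
        using p \<alpha> nn_integral_Gamma[of "1 - \<alpha>" p] by (subst set_nn_integral_mult_left) auto
      finally show "(\<integral>\<^sup>+t\<in>{0<..}. ennreal (exp (- (p * t))) *
          (f s * ennreal ((t - s) powr (- \<alpha>)) * indicator {0<..} (t - s)) \<partial>lborel)
          = ennreal (Gamma (1 - \<alpha>) * p powr (\<alpha> - 1)) * (ennreal (exp (- (p * s))) * f s)"
        by (simp add: mult.commute)
    qed
    also have "\<dots> = ennreal (Gamma (1 - \<alpha>) * p powr (\<alpha> - 1)) * ennreal (exp (- (p powr \<alpha>)))"
      using p by (subst set_nn_integral_mult_left) (auto simp: laplace)
    finally show ?thesis using G by (simp add: ennreal_mult[symmetric] mult_ac)
  qed
  have exp_tail: "(\<integral>\<^sup>+p\<in>{0<..}. ennreal (exp (- (p * t))) * indicator {s<..} p \<partial>lborel)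
      = ennreal (exp (- (s * t)) / t)" if t: "0 < t" and s: "0 \<le> s" for s t :: real
  proof -
    have "(\<integral>\<^sup>+p\<in>{0<..}. ennreal (exp (- (p * t))) * indicator {s<..} p \<partial>lborel)
      = (\<integral>\<^sup>+r. ennreal (exp (- ((s + 1 * r) * t))) * indicator {s<..} (s + 1 * r) * indicator {0<..} (s + 1 * r) \<partial>lborel)"
      by (subst nn_integral_real_affine[of _ 1 s]) auto
    also have "\<dots> = (\<integral>\<^sup>+r\<in>{0<..}. ennreal (exp (- (s * t))) * ennreal (r powr (1 - 1) * exp (- (r * t))) \<partial>lborel)"
      using s by (auto intro!: nn_integral_cong split: split_indicator simp: ennreal_mult[symmetric] algebra_simps exp_add[symmetric])
    also have "\<dots> = ennreal (exp (- (s * t))) * ennreal (Gamma 1 * t powr (- 1))"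
      using t by (subst set_nn_integral_mult_left, measurable) (subst nn_integral_Gamma, auto)
    finally show ?thesis using t by (simp add: ennreal_mult[symmetric] powr_minus divide_inverse)
  qed
  have lap_k: "(\<integral>\<^sup>+t\<in>{0<..}. ennreal (exp (- (s * t))) * (ennreal (c / t) * k t) \<partial>lborel)
      = ennreal (exp (- (s powr \<alpha>)))" if s: "0 \<le> s" for s
  proof -
    have "(\<integral>\<^sup>+t\<in>{0<..}. ennreal (exp (- (s * t))) * (ennreal (c / t) * k t) \<partial>lborel)
       = (\<integral>\<^sup>+t\<in>{0<..}. (\<integral>\<^sup>+p\<in>{0<..}. (ennreal c * k t) * (ennreal (exp (- (p * t))) * indicator {s<..} p) \<partial>lborel) \<partial>lborel)"
    proof (rule set_nn_integral_eqI)
      fix t :: real assume "t \<in> {0<..}"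
      then have t: "0 < t" by simp
      have "(\<integral>\<^sup>+p\<in>{0<..}. (ennreal c * k t) * (ennreal (exp (- (p * t))) * indicator {s<..} p) \<partial>lborel)
          = (ennreal c * k t) * ennreal (exp (- (s * t)) / t)"
        by (subst set_nn_integral_mult_left) (auto simp: exp_tail t s)
      also have "\<dots> = (ennreal c * ennreal (exp (- (s * t)) / t)) * k t"
        by (simp only: mult_ac)
      also have "\<dots> = (ennreal (exp (- (s * t))) * ennreal (c / t)) * k t"
        using c t by (simp add: ennreal_mult[symmetric] mult.commute)
      finally show "ennreal (exp (- (s * t))) * (ennreal (c / t) * k t) =
          (\<integral>\<^sup>+p\<in>{0<..}. (ennreal c * k t) * (ennreal (exp (- (p * t))) * indicator {s<..} p) \<partial>lborel)"
        by (simp add: mult.assoc)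
    qed
    also have "\<dots> = (\<integral>\<^sup>+p\<in>{0<..}. (\<integral>\<^sup>+t\<in>{0<..}. (ennreal c * k t) * (ennreal (exp (- (p * t))) * indicator {s<..} p) \<partial>lborel) \<partial>lborel)"
      by (rule set_nn_integral_swap) auto
    also have "\<dots> = (\<integral>\<^sup>+p\<in>{0<..}. (\<integral>\<^sup>+t\<in>{0<..}. (ennreal c * indicator {s<..} p) * (ennreal (exp (- (p * t))) * k t) \<partial>lborel) \<partial>lborel)"
      by (simp only: mult_ac)
    \<comment> \<open>Written as a function of \<open>p powr \<alpha>\<close>, ready for the power substitution \<open>x = p powr \<alpha>\<close>.\<close>
    also have "\<dots> = (\<integral>\<^sup>+p\<in>{0<..}. ennreal (\<alpha> * p powr (\<alpha> - 1)) *
        (ennreal (exp (- ((p powr \<alpha>) * 1))) * indicator {s powr \<alpha><..} (p powr \<alpha>)) \<partial>lborel)"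
    proof (rule set_nn_integral_eqI)
      fix p :: real assume "p \<in> {0<..}"
      then have p: "0 < p" by simp
      have ind: "indicator {s<..} p = (indicator {s powr \<alpha><..} (p powr \<alpha>) :: ennreal)"
        using p s \<alpha> by (auto split: split_indicator simp: powr_less_mono2 dest: powr_less_cancel2[rotated 3])
      have "c * (Gamma (1 - \<alpha>) * (p powr (\<alpha> - 1) * exp (- (p powr \<alpha>)))) = \<alpha> * p powr (\<alpha> - 1) * exp (- (p powr \<alpha>))"
        using G by (simp add: c_def)
      then have "ennreal c * ennreal (Gamma (1 - \<alpha>) * (p powr (\<alpha> - 1) * exp (- (p powr \<alpha>))))
         = ennreal (\<alpha> * p powr (\<alpha> - 1)) * ennreal (exp (- (p powr \<alpha>)))"
        using c \<alpha> G by (simp add: ennreal_mult[symmetric])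
      then show "(\<integral>\<^sup>+t\<in>{0<..}. (ennreal c * indicator {s<..} p) * (ennreal (exp (- (p * t))) * k t) \<partial>lborel)
        = ennreal (\<alpha> * p powr (\<alpha> - 1)) *
        (ennreal (exp (- ((p powr \<alpha>) * 1))) * indicator {s powr \<alpha><..} (p powr \<alpha>))"
        by (subst set_nn_integral_mult_left) (auto simp: conv[OF p] ind split: split_indicator)
    qed
    also have "\<dots> = (\<integral>\<^sup>+x\<in>{0<..}. ennreal (exp (- (x * 1))) * indicator {s powr \<alpha><..} x \<partial>lborel)"
      by (rule nn_integral_power_substitution[symmetric]) (use \<alpha> in auto)
    also have "\<dots> = ennreal (exp (- (s powr \<alpha>)))"
      by (subst exp_tail) auto
    finally show ?thesis .
  qed
  have "AE t in lborel. 0 < t \<longrightarrow> f t = ennreal (c / t) * k t"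
  proof (rule laplace_transform_unique)
    show "(\<integral>\<^sup>+t\<in>{0<..}. f t \<partial>lborel) < \<infinity>" using laplace[of 0] by simp
  qed (auto simp: laplace lap_k)
  then show ?thesis unfolding c_def k_def .
qed

text \<open>
  If \<open>f t = 0\<close> at a point where the integral equation holds, then the integral on its right
  vanishes, so \<open>f\<close> is zero almost everywhere on \<open>(0, t)\<close>. The Laplace transform would
  then be at most \<open>exp (- s t)\<close>, but \<open>exp (- s powr \<alpha>)\<close> decays more slowly
  because \<open>\<alpha> < 1\<close>.
\<close>

lemma stable_density_positive:
  fixes f :: "real \<Rightarrow> ennreal"
  assumes f [measurable]: "f \<in> borel_measurable borel" and \<alpha>: "0 < \<alpha>" "\<alpha> < 1"
    and laplace: "\<And>s. 0 \<le> s \<Longrightarrow>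
      (\<integral>\<^sup>+t\<in>{0<..}. ennreal (exp (- (s * t))) * f t \<partial>lborel) = ennreal (exp (- (s powr \<alpha>)))"
  shows "AE t in lborel. 0 < t \<longrightarrow> f t \<noteq> 0"
proof -
  have "AE t in lborel. 0 < t \<longrightarrow> f t = ennreal (\<alpha> / Gamma (1 - \<alpha>) / t)
           * (\<integral>\<^sup>+s\<in>{0<..}. f s * ennreal ((t - s) powr (- \<alpha>)) * indicator {0<..} (t - s) \<partial>lborel)"
    by (rule stable_density_integral_equation[OF f \<alpha>]) (rule laplace)
  then show ?thesis
  proof eventually_elim
    case (elim t)
    show ?case
    proof (intro impI notI)
      assume t: "0 < t" and "f t = 0"
      have "0 < Gamma (1 - \<alpha>)" using \<alpha> by (intro Gamma_real_pos) simp
      then have "ennreal (\<alpha> / Gamma (1 - \<alpha>) / t) \<noteq> 0" using \<alpha> t by (simp add: ennreal_eq_0_iff not_le)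
      with elim t \<open>f t = 0\<close> have "(\<integral>\<^sup>+s\<in>{0<..}. f s * ennreal ((t - s) powr (- \<alpha>)) * indicator {0<..} (t - s) \<partial>lborel) = 0"
        by auto
      then have "AE s in lborel. f s * ennreal ((t - s) powr (- \<alpha>)) * indicator {0<..} (t - s) * indicator {0<..} s = 0"
        by (subst (asm) nn_integral_0_iff_AE) auto
      then have zero: "AE s in lborel. 0 < s \<and> s < t \<longrightarrow> f s = 0"
        by eventually_elim (auto split: split_indicator_asm simp: ennreal_eq_0_iff not_le)
      have bound: "exp (- (s powr \<alpha>)) \<le> exp (- (s * t))" if s: "0 \<le> s" for s
      proof -
        have "ennreal (exp (- (s powr \<alpha>))) = (\<integral>\<^sup>+x\<in>{0<..}. ennreal (exp (- (s * x))) * f x \<partial>lborel)"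
          by (rule laplace[OF s, symmetric])
        also have "\<dots> \<le> (\<integral>\<^sup>+x\<in>{0<..}. ennreal (exp (- (s * t))) * f x \<partial>lborel)"
        proof (rule nn_integral_mono_AE, use zero in eventually_elim)
          case (elim x)
          then show ?case
            using s by (cases "x < t") (auto split: split_indicator intro!: mult_right_mono ennreal_leI mult_left_mono)
        qed
        also have "\<dots> = ennreal (exp (- (s * t)))"
          using laplace[of 0] by (subst set_nn_integral_mult_left) auto
        finally show ?thesis by simp
      qed
      \<comment> \<open>Chosen so that \<open>s t = 2 (s powr \<alpha>)\<close>, which contradicts the bound.\<close>
      define s where "s = (2 / t) powr (1 / (1 - \<alpha>))"
      have s: "0 < s" using t by (simp add: s_def)
      have "s powr (1 - \<alpha>) = 2 / t" using t \<alpha> by (simp add: s_def powr_powr)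
      then have "s * t = 2 * s powr \<alpha>" using s t by (simp add: powr_diff field_simps)
      moreover have "s * t \<le> s powr \<alpha>" using bound[of s] s by simp
      ultimately show False using s by (simp add: not_le[symmetric])
    qed
  qed
qed

section \<open>Two mixtures with the same density\<close>

text \<open>
  Up to constants, \<open>y powr (a - 1)\<close> times this function is the density of
  \<open>G powr (1 / \<alpha>) * B\<close> for independent \<open>G\<close> of law gamma\<open>(b / \<alpha>, 1)\<close>
  and \<open>B\<close> of law beta\<open>(a, d)\<close>, where \<open>a + d = b + c\<close>.
\<close>

definition shifted_weight :: "real \<Rightarrow> real \<Rightarrow> real \<Rightarrow> real \<Rightarrow> ennreal" where
  "shifted_weight \<alpha> c d y =
     (\<integral>\<^sup>+z\<in>{0<..}. ennreal (z powr (d - 1) * (y + z) powr (- c) * exp (- ((y + z) powr \<alpha>))) \<partial>lborel)"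

lemma shifted_weight_measurable [measurable]: "shifted_weight \<alpha> c d \<in> borel_measurable borel"
  unfolding shifted_weight_def[abs_def] by measurable

text \<open>
  For fixed \<open>y\<close>, polar coordinates \<open>s = t u\<close>, \<open>r = t (1 - u)\<close> separate the
  argument of \<open>f\<close> from the residual \<open>r\<close>. What remains coupled is
  \<open>(s + r) powr (- d)\<close>, where \<open>d = b + c - a\<close>; writing it as a gamma integral over
  \<open>z\<close> replaces the coupling by \<open>exp (- z (s + r))\<close>. The \<open>r\<close>-integral is then a
  gamma integral, and the \<open>s\<close>-integral is the Laplace transform of \<open>f\<close> at
  \<open>y + z\<close>.
\<close>

lemma stable_residual_integral:
  fixes f :: "real \<Rightarrow> ennreal"
  assumes f [measurable]: "f \<in> borel_measurable borel"
    and laplace: "\<And>s. 0 < s \<Longrightarrow>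
      (\<integral>\<^sup>+t\<in>{0<..}. ennreal (exp (- (s * t))) * f t \<partial>lborel) = ennreal (exp (- (s powr \<alpha>)))"
    and pos: "0 < c" "0 < d" and abcd: "a + d = b + c" and y: "0 < y"
  shows "(\<integral>\<^sup>+t\<in>{0<..}. ennreal (t powr (a - b) * exp (- (t * y)))
            * (\<integral>\<^sup>+u\<in>{0<..<1}. f (t * u) * ennreal ((1 - u) powr (c - 1)) \<partial>lborel) \<partial>lborel)
       = ennreal (Gamma c / Gamma d) * shifted_weight \<alpha> c d y"
proof -
  have G: "0 < Gamma c" "0 < Gamma d" using pos by (auto intro: Gamma_real_pos)
  let ?H = "\<lambda>s r. f s * ennreal (r powr (c - 1) * (s + r) powr (- d) * exp (- ((s + r) * y)))"
  have "(\<integral>\<^sup>+t\<in>{0<..}. ennreal (t powr (a - b) * exp (- (t * y)))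
            * (\<integral>\<^sup>+u\<in>{0<..<1}. f (t * u) * ennreal ((1 - u) powr (c - 1)) \<partial>lborel) \<partial>lborel)
      = (\<integral>\<^sup>+t\<in>{0<..}. (\<integral>\<^sup>+u\<in>{0<..<1}. ennreal t * ?H (t * u) (t * (1 - u)) \<partial>lborel) \<partial>lborel)"
  proof (rule set_nn_integral_eqI)
    fix t :: real assume "t \<in> {0<..}"
    then have t: "0 < t" by simp
    show "ennreal (t powr (a - b) * exp (- (t * y)))
            * (\<integral>\<^sup>+u\<in>{0<..<1}. f (t * u) * ennreal ((1 - u) powr (c - 1)) \<partial>lborel)
        = (\<integral>\<^sup>+u\<in>{0<..<1}. ennreal t * ?H (t * u) (t * (1 - u)) \<partial>lborel)"
    proof (subst set_nn_integral_mult_left[symmetric], measurable, rule set_nn_integral_eqI)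
      fix u :: real assume "u \<in> {0<..<1}"
      then have u: "0 < u" "u < 1" by auto
      \<comment> \<open>The exponent count of the Jacobian \<open>t\<close>, of \<open>(t (1 - u)) powr (c - 1)\<close> and of \<open>t powr (- d)\<close>.\<close>
      have e: "a - b = 1 + (c - 1) + (- d)" using abcd by simp
      have "t powr (a - b) = t * t powr (c - 1) * t powr (- d)"
        unfolding e powr_add using t by simp
      moreover have "t * u + t * (1 - u) = t" by (simp add: algebra_simps)
      ultimately have "t powr (a - b) * exp (- (t * y)) * (1 - u) powr (c - 1)
        = t * ((t * (1 - u)) powr (c - 1) * (t * u + t * (1 - u)) powr (- d) * exp (- ((t * u + t * (1 - u)) * y)))"
        using t u by (simp add: powr_mult)
      then have "ennreal (t powr (a - b) * exp (- (t * y))) * ennreal ((1 - u) powr (c - 1))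
        = ennreal t * ennreal ((t * (1 - u)) powr (c - 1) * (t * u + t * (1 - u)) powr (- d) * exp (- ((t * u + t * (1 - u)) * y)))"
        using t by (simp add: ennreal_mult[symmetric])
      then show "ennreal (t powr (a - b) * exp (- (t * y))) * (f (t * u) * ennreal ((1 - u) powr (c - 1)))
          = ennreal t * ?H (t * u) (t * (1 - u))"
        by (simp only: mult_ac mult.left_commute[of "f (t * u)"])
    qed
  qed
  also have "\<dots> = (\<integral>\<^sup>+s\<in>{0<..}. (\<integral>\<^sup>+r\<in>{0<..}. ?H s r \<partial>lborel) \<partial>lborel)"
    by (rule nn_integral_polar) measurable
  also have "\<dots> = (\<integral>\<^sup>+s\<in>{0<..}. (\<integral>\<^sup>+z\<in>{0<..}. ennreal (Gamma c / Gamma d * (z powr (d - 1) * (y + z) powr (- c)))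
       * (ennreal (exp (- ((y + z) * s))) * f s) \<partial>lborel) \<partial>lborel)"
  proof (rule set_nn_integral_eqI)
    fix s :: real assume "s \<in> {0<..}"
    then have s: "0 < s" by simp
    have "(\<integral>\<^sup>+r\<in>{0<..}. ?H s r \<partial>lborel)
      = (\<integral>\<^sup>+r\<in>{0<..}. (\<integral>\<^sup>+z\<in>{0<..}. f s * (ennreal (r powr (c - 1) * exp (- ((s + r) * y)) / Gamma d) *
           ennreal (z powr (d - 1) * exp (- (z * (s + r))))) \<partial>lborel) \<partial>lborel)"
    proof (rule set_nn_integral_eqI)
      fix r :: real assume "r \<in> {0<..}"
      then have r: "0 < r" by simp
      have "(\<integral>\<^sup>+z\<in>{0<..}. f s * (ennreal (r powr (c - 1) * exp (- ((s + r) * y)) / Gamma d) *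
           ennreal (z powr (d - 1) * exp (- (z * (s + r))))) \<partial>lborel)
        = f s * (ennreal (r powr (c - 1) * exp (- ((s + r) * y)) / Gamma d) * ennreal (Gamma d * (s + r) powr (- d)))"
        using s r pos by (simp add: set_nn_integral_mult_left nn_integral_Gamma)
      also have "\<dots> = ?H s r"
        using s r G by (simp add: ennreal_mult[symmetric] mult_ac)
      finally show "?H s r = (\<integral>\<^sup>+z\<in>{0<..}. f s * (ennreal (r powr (c - 1) * exp (- ((s + r) * y)) / Gamma d) *
           ennreal (z powr (d - 1) * exp (- (z * (s + r))))) \<partial>lborel)" ..
    qed
    also have "\<dots> = (\<integral>\<^sup>+z\<in>{0<..}. (\<integral>\<^sup>+r\<in>{0<..}. f s * (ennreal (r powr (c - 1) * exp (- ((s + r) * y)) / Gamma d) *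
           ennreal (z powr (d - 1) * exp (- (z * (s + r))))) \<partial>lborel) \<partial>lborel)"
      by (rule set_nn_integral_swap) measurable
    also have "\<dots> = (\<integral>\<^sup>+z\<in>{0<..}. ennreal (Gamma c / Gamma d * (z powr (d - 1) * (y + z) powr (- c)))
       * (ennreal (exp (- ((y + z) * s))) * f s) \<partial>lborel)"
    proof (rule set_nn_integral_eqI)
      fix z :: real assume "z \<in> {0<..}"
      then have z: "0 < z" by simp
      have "(\<integral>\<^sup>+r\<in>{0<..}. f s * (ennreal (r powr (c - 1) * exp (- ((s + r) * y)) / Gamma d) *
           ennreal (z powr (d - 1) * exp (- (z * (s + r))))) \<partial>lborel)
       = (\<integral>\<^sup>+r\<in>{0<..}. f s * (ennreal (z powr (d - 1) * exp (- ((y + z) * s)) / Gamma d) *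
           ennreal (r powr (c - 1) * exp (- (r * (y + z))))) \<partial>lborel)"
      proof (rule set_nn_integral_eqI)
        fix r :: real
        have "exp (- ((s + r) * y)) * exp (- (z * (s + r))) = exp (- ((y + z) * s)) * exp (- (r * (y + z)))"
          by (simp add: exp_add[symmetric] algebra_simps)
        then have "(r powr (c - 1) * z powr (d - 1) / Gamma d) * (exp (- ((s + r) * y)) * exp (- (z * (s + r))))
          = (r powr (c - 1) * z powr (d - 1) / Gamma d) * (exp (- ((y + z) * s)) * exp (- (r * (y + z))))"
          by (rule arg_cong)
        then have "ennreal ((r powr (c - 1) * exp (- ((s + r) * y)) / Gamma d) * (z powr (d - 1) * exp (- (z * (s + r)))))
          = ennreal ((z powr (d - 1) * exp (- ((y + z) * s)) / Gamma d) * (r powr (c - 1) * exp (- (r * (y + z)))))"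
          by (intro arg_cong[where f = ennreal]) (simp only: times_divide_eq_left times_divide_eq_right mult_ac)
        then show "f s * (ennreal (r powr (c - 1) * exp (- ((s + r) * y)) / Gamma d) *
           ennreal (z powr (d - 1) * exp (- (z * (s + r)))))
         = f s * (ennreal (z powr (d - 1) * exp (- ((y + z) * s)) / Gamma d) *
           ennreal (r powr (c - 1) * exp (- (r * (y + z)))))"
          using G by (subst (1 2) ennreal_mult[symmetric]) (simp_all only: divide_nonneg_pos mult_nonneg_nonneg powr_ge_zero exp_ge_zero)
      qed
      also have "\<dots> = f s * (ennreal (z powr (d - 1) * exp (- ((y + z) * s)) / Gamma d) * ennreal (Gamma c * (y + z) powr (- c)))"
        using y z pos by (simp add: set_nn_integral_mult_left nn_integral_Gamma)
      also have "\<dots> = f s * (ennreal (Gamma c / Gamma d * (z powr (d - 1) * (y + z) powr (- c))) * ennreal (exp (- ((y + z) * s))))"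
        using y z G by (simp add: ennreal_mult[symmetric] mult_ac)
      finally show "(\<integral>\<^sup>+r\<in>{0<..}. f s * (ennreal (r powr (c - 1) * exp (- ((s + r) * y)) / Gamma d) *
           ennreal (z powr (d - 1) * exp (- (z * (s + r))))) \<partial>lborel)
       = ennreal (Gamma c / Gamma d * (z powr (d - 1) * (y + z) powr (- c)))
         * (ennreal (exp (- ((y + z) * s))) * f s)"
        by (simp only: mult_ac)
    qed
    finally show "(\<integral>\<^sup>+r\<in>{0<..}. ?H s r \<partial>lborel) = (\<integral>\<^sup>+z\<in>{0<..}. ennreal (Gamma c / Gamma d * (z powr (d - 1) * (y + z) powr (- c)))
       * (ennreal (exp (- ((y + z) * s))) * f s) \<partial>lborel)" .
  qed
  also have "\<dots> = (\<integral>\<^sup>+z\<in>{0<..}. (\<integral>\<^sup>+s\<in>{0<..}. ennreal (Gamma c / Gamma d * (z powr (d - 1) * (y + z) powr (- c)))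
       * (ennreal (exp (- ((y + z) * s))) * f s) \<partial>lborel) \<partial>lborel)"
    by (rule set_nn_integral_swap) measurable
  also have "\<dots> = (\<integral>\<^sup>+z\<in>{0<..}. ennreal (Gamma c / Gamma d) *
      ennreal (z powr (d - 1) * (y + z) powr (- c) * exp (- ((y + z) powr \<alpha>))) \<partial>lborel)"
  proof (rule set_nn_integral_eqI)
    fix z :: real assume "z \<in> {0<..}"
    then have z: "0 < z" by simp
    show "(\<integral>\<^sup>+s\<in>{0<..}. ennreal (Gamma c / Gamma d * (z powr (d - 1) * (y + z) powr (- c)))
       * (ennreal (exp (- ((y + z) * s))) * f s) \<partial>lborel)
      = ennreal (Gamma c / Gamma d) *
      ennreal (z powr (d - 1) * (y + z) powr (- c) * exp (- ((y + z) powr \<alpha>)))"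
      using y z G by (subst set_nn_integral_mult_left, measurable) (subst laplace, auto simp: ennreal_mult[symmetric] mult_ac)
  qed
  also have "\<dots> = ennreal (Gamma c / Gamma d) * shifted_weight \<alpha> c d y"
    unfolding shifted_weight_def by (rule set_nn_integral_mult_left) measurable
  finally show ?thesis .
qed

text \<open>
  The left side is, up to constants, the expectation of \<open>\<phi> (G * B / T)\<close> with independent
  gamma, beta and tilted stable variables \<open>G\<close>, \<open>B\<close> and \<open>T\<close>. Substituting
  \<open>x = t y\<close> makes the value \<open>y\<close> of this ratio an integration variable and leaves the
  integral over \<open>t\<close> evaluated in \<open>stable_residual_integral\<close>.
\<close>

lemma stable_gamma_mixture:
  fixes f \<phi> :: "real \<Rightarrow> ennreal"
  assumes f [measurable]: "f \<in> borel_measurable borel" and \<phi> [measurable]: "\<phi> \<in> borel_measurable borel"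
    and laplace: "\<And>s. 0 < s \<Longrightarrow>
      (\<integral>\<^sup>+t\<in>{0<..}. ennreal (exp (- (s * t))) * f t \<partial>lborel) = ennreal (exp (- (s powr \<alpha>)))"
    and pos: "0 < c" "0 < d" and abcd: "a + d = b + c"
  shows "(\<integral>\<^sup>+t\<in>{0<..}. ennreal (t powr (- b))
            * (\<integral>\<^sup>+u\<in>{0<..<1}. f (t * u) * ennreal ((1 - u) powr (c - 1)) \<partial>lborel)
            * (\<integral>\<^sup>+x\<in>{0<..}. \<phi> (x / t) * ennreal (x powr (a - 1) * exp (- x)) \<partial>lborel) \<partial>lborel)
       = ennreal (Gamma c / Gamma d)
         * (\<integral>\<^sup>+y\<in>{0<..}. \<phi> y * ennreal (y powr (a - 1)) * shifted_weight \<alpha> c d y \<partial>lborel)"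
proof -
  define I where "I t = (\<integral>\<^sup>+u\<in>{0<..<1}. f (t * u) * ennreal ((1 - u) powr (c - 1)) \<partial>lborel)" for t
  have I [measurable]: "I \<in> borel_measurable borel" unfolding I_def[abs_def] by measurable
  have "(\<integral>\<^sup>+t\<in>{0<..}. ennreal (t powr (- b)) * I t
            * (\<integral>\<^sup>+x\<in>{0<..}. \<phi> (x / t) * ennreal (x powr (a - 1) * exp (- x)) \<partial>lborel) \<partial>lborel)
     = (\<integral>\<^sup>+t\<in>{0<..}. (\<integral>\<^sup>+y\<in>{0<..}. (\<phi> y * ennreal (y powr (a - 1)))
           * (ennreal (t powr (a - b) * exp (- (t * y))) * I t) \<partial>lborel) \<partial>lborel)"
  proof (rule set_nn_integral_eqI)
    fix t :: real assume "t \<in> {0<..}"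
    then have t: "0 < t" by simp
    have "(\<integral>\<^sup>+x\<in>{0<..}. \<phi> (x / t) * ennreal (x powr (a - 1) * exp (- x)) \<partial>lborel)
      = (\<integral>\<^sup>+y\<in>{0<..}. ennreal t * (\<phi> (t * y / t) * ennreal ((t * y) powr (a - 1) * exp (- (t * y)))) \<partial>lborel)"
      using t by (subst nn_integral_Ioi_scale[of _ t]) auto
    then have "ennreal (t powr (- b)) * I t * (\<integral>\<^sup>+x\<in>{0<..}. \<phi> (x / t) * ennreal (x powr (a - 1) * exp (- x)) \<partial>lborel)
      = (\<integral>\<^sup>+y\<in>{0<..}. ennreal (t powr (- b)) * I t * (ennreal t * (\<phi> (t * y / t) * ennreal ((t * y) powr (a - 1) * exp (- (t * y))))) \<partial>lborel)"
      by (simp only:) (rule set_nn_integral_mult_left[symmetric]; measurable)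
    also have "\<dots> = (\<integral>\<^sup>+y\<in>{0<..}. (\<phi> y * ennreal (y powr (a - 1)))
           * (ennreal (t powr (a - b) * exp (- (t * y))) * I t) \<partial>lborel)"
    proof (rule set_nn_integral_eqI)
      fix y :: real assume "y \<in> {0<..}"
      then have y: "0 < y" by simp
      have e: "a - b = (- b) + 1 + (a - 1)" by simp
      have "t powr (a - b) = t powr (- b) * t * t powr (a - 1)"
        unfolding e powr_add using t by simp
      then have "t powr (- b) * (t * ((t * y) powr (a - 1) * exp (- (t * y)))) = y powr (a - 1) * (t powr (a - b) * exp (- (t * y)))"
        using t y by (simp add: powr_mult)
      then have eq: "ennreal (t powr (- b)) * (ennreal t * ennreal ((t * y) powr (a - 1) * exp (- (t * y))))
         = ennreal (y powr (a - 1)) * ennreal (t powr (a - b) * exp (- (t * y)))"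
        using t by (simp add: ennreal_mult[symmetric])
      have "ennreal (t powr (- b)) * I t * (ennreal t * (\<phi> y * ennreal ((t * y) powr (a - 1) * exp (- (t * y)))))
         = (ennreal (t powr (- b)) * (ennreal t * ennreal ((t * y) powr (a - 1) * exp (- (t * y))))) * (\<phi> y * I t)"
        by (simp only: mult_ac)
      also have "\<dots> = (\<phi> y * ennreal (y powr (a - 1))) * (ennreal (t powr (a - b) * exp (- (t * y))) * I t)"
        unfolding eq by (simp only: mult_ac)
      finally show "ennreal (t powr (- b)) * I t * (ennreal t * (\<phi> (t * y / t) * ennreal ((t * y) powr (a - 1) * exp (- (t * y)))))
         = (\<phi> y * ennreal (y powr (a - 1))) * (ennreal (t powr (a - b) * exp (- (t * y))) * I t)"
        using t by simp
    qed
    finally show "ennreal (t powr (- b)) * I t * (\<integral>\<^sup>+x\<in>{0<..}. \<phi> (x / t) * ennreal (x powr (a - 1) * exp (- x)) \<partial>lborel)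
      = (\<integral>\<^sup>+y\<in>{0<..}. (\<phi> y * ennreal (y powr (a - 1)))
           * (ennreal (t powr (a - b) * exp (- (t * y))) * I t) \<partial>lborel)" .
  qed
  also have "\<dots> = (\<integral>\<^sup>+y\<in>{0<..}. (\<integral>\<^sup>+t\<in>{0<..}. (\<phi> y * ennreal (y powr (a - 1)))
           * (ennreal (t powr (a - b) * exp (- (t * y))) * I t) \<partial>lborel) \<partial>lborel)"
    by (rule set_nn_integral_swap) measurable
  also have "\<dots> = (\<integral>\<^sup>+y\<in>{0<..}. ennreal (Gamma c / Gamma d) * (\<phi> y * ennreal (y powr (a - 1)) * shifted_weight \<alpha> c d y) \<partial>lborel)"
  proof (rule set_nn_integral_eqI)
    fix y :: real assume "y \<in> {0<..}"
    then have y: "0 < y" by simp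
    have "(\<integral>\<^sup>+t\<in>{0<..}. (\<phi> y * ennreal (y powr (a - 1))) * (ennreal (t powr (a - b) * exp (- (t * y))) * I t) \<partial>lborel)
      = (\<phi> y * ennreal (y powr (a - 1))) * (\<integral>\<^sup>+t\<in>{0<..}. ennreal (t powr (a - b) * exp (- (t * y))) * I t \<partial>lborel)"
      by (rule set_nn_integral_mult_left) measurable
    also have "(\<integral>\<^sup>+t\<in>{0<..}. ennreal (t powr (a - b) * exp (- (t * y))) * I t \<partial>lborel) = ennreal (Gamma c / Gamma d) * shifted_weight \<alpha> c d y"
      unfolding I_def by (rule stable_residual_integral[OF f laplace pos abcd y])
    finally show "(\<integral>\<^sup>+t\<in>{0<..}. (\<phi> y * ennreal (y powr (a - 1))) * (ennreal (t powr (a - b) * exp (- (t * y))) * I t) \<partial>lborel)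
      = ennreal (Gamma c / Gamma d) * (\<phi> y * ennreal (y powr (a - 1)) * shifted_weight \<alpha> c d y)"
      by (simp only: mult_ac)
  qed
  also have "\<dots> = ennreal (Gamma c / Gamma d)
         * (\<integral>\<^sup>+y\<in>{0<..}. \<phi> y * ennreal (y powr (a - 1)) * shifted_weight \<alpha> c d y \<partial>lborel)"
    by (rule set_nn_integral_mult_left) measurable
  finally show ?thesis unfolding I_def .
qed

text \<open>
  The other side in the same form: \<open>x = q powr \<alpha>\<close> turns the gamma variable into a power of
  \<open>q\<close>, and polar coordinates \<open>y = q v\<close>, \<open>z = q (1 - v)\<close> make the argument of
  \<open>\<phi>\<close> the first variable. Here \<open>exp (- (y + z) powr \<alpha>)\<close> comes from the gamma
  density, whereas in \<open>stable_residual_integral\<close> it is the Laplace transform of the stable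
  density; this coincidence is the reason for the theorem.
\<close>

lemma gamma_beta_mixture:
  fixes \<phi> :: "real \<Rightarrow> ennreal"
  assumes \<phi> [measurable]: "\<phi> \<in> borel_measurable borel"
    and \<alpha>: "0 < \<alpha>" and abcd: "a + d = b + c"
  shows "(\<integral>\<^sup>+x\<in>{0<..}. (\<integral>\<^sup>+v\<in>{0<..<1}. \<phi> (x powr (1 / \<alpha>) * v)
            * ennreal (x powr (b / \<alpha> - 1) * exp (- x) * (v powr (a - 1) * (1 - v) powr (d - 1))) \<partial>lborel) \<partial>lborel)
       = ennreal \<alpha> * (\<integral>\<^sup>+y\<in>{0<..}. \<phi> y * ennreal (y powr (a - 1)) * shifted_weight \<alpha> c d y \<partial>lborel)"
proof -
  let ?H = "\<lambda>y z. (\<phi> y * ennreal (y powr (a - 1))) * ennreal (z powr (d - 1) * (y + z) powr (- c) * exp (- ((y + z) powr \<alpha>)))"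
  have "(\<integral>\<^sup>+x\<in>{0<..}. (\<integral>\<^sup>+v\<in>{0<..<1}. \<phi> (x powr (1 / \<alpha>) * v)
            * ennreal (x powr (b / \<alpha> - 1) * exp (- x) * (v powr (a - 1) * (1 - v) powr (d - 1))) \<partial>lborel) \<partial>lborel)
    = (\<integral>\<^sup>+q\<in>{0<..}. ennreal (\<alpha> * q powr (\<alpha> - 1)) * (\<integral>\<^sup>+v\<in>{0<..<1}. \<phi> ((q powr \<alpha>) powr (1 / \<alpha>) * v)
            * ennreal ((q powr \<alpha>) powr (b / \<alpha> - 1) * exp (- (q powr \<alpha>)) * (v powr (a - 1) * (1 - v) powr (d - 1))) \<partial>lborel) \<partial>lborel)"
    by (rule nn_integral_power_substitution) (use \<alpha> in measurable)
  also have "\<dots> = (\<integral>\<^sup>+q\<in>{0<..}. ennreal \<alpha> * (\<integral>\<^sup>+v\<in>{0<..<1}. ennreal q * ?H (q * v) (q * (1 - v)) \<partial>lborel) \<partial>lborel)"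
  proof (rule set_nn_integral_eqI)
    fix q :: real assume "q \<in> {0<..}"
    then have q: "0 < q" by simp
    have "ennreal (\<alpha> * q powr (\<alpha> - 1)) * (\<phi> ((q powr \<alpha>) powr (1 / \<alpha>) * v)
            * ennreal ((q powr \<alpha>) powr (b / \<alpha> - 1) * exp (- (q powr \<alpha>)) * (v powr (a - 1) * (1 - v) powr (d - 1))))
        = ennreal \<alpha> * (ennreal q * ?H (q * v) (q * (1 - v)))" if "v \<in> {0<..<1}" for v
    proof -
      from that have v: "0 < v" "v < 1" by auto
      have sum: "q * v + q * (1 - v) = q" by (simp add: algebra_simps)
      \<comment> \<open>All powers of \<open>q\<close> match because \<open>a + d = b + c\<close>.\<close>
      have e: "\<alpha> - 1 + (b - \<alpha>) = 1 + (a - 1) + (d - 1) + (- c)" using abcd by simp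
      have "q powr (\<alpha> - 1) * q powr (b - \<alpha>) = q * q powr (a - 1) * q powr (d - 1) * q powr (- c)"
        unfolding powr_add[symmetric] e unfolding powr_add using q by simp
      then have "\<alpha> * q powr (\<alpha> - 1) * (q powr (b - \<alpha>) * exp (- (q powr \<alpha>)) * (v powr (a - 1) * (1 - v) powr (d - 1)))
         = \<alpha> * (q * ((q * v) powr (a - 1) * ((q * (1 - v)) powr (d - 1) * q powr (- c) * exp (- (q powr \<alpha>)))))"
        using q v by (simp add: powr_mult)
      then have eq: "ennreal (\<alpha> * q powr (\<alpha> - 1)) * ennreal (q powr (b - \<alpha>) * exp (- (q powr \<alpha>)) * (v powr (a - 1) * (1 - v) powr (d - 1)))
         = ennreal \<alpha> * (ennreal q * (ennreal ((q * v) powr (a - 1)) * ennreal ((q * (1 - v)) powr (d - 1) * q powr (- c) * exp (- (q powr \<alpha>)))))"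
        using q \<alpha> by (simp add: ennreal_mult[symmetric])
      have s1: "(q powr \<alpha>) powr (1 / \<alpha>) = q" "(q powr \<alpha>) powr (b / \<alpha> - 1) = q powr (b - \<alpha>)"
        using q \<alpha> by (auto simp: powr_powr algebra_simps)
      have "ennreal (\<alpha> * q powr (\<alpha> - 1)) * (\<phi> (q * v)
            * ennreal (q powr (b - \<alpha>) * exp (- (q powr \<alpha>)) * (v powr (a - 1) * (1 - v) powr (d - 1))))
         = \<phi> (q * v) * (ennreal (\<alpha> * q powr (\<alpha> - 1)) * ennreal (q powr (b - \<alpha>) * exp (- (q powr \<alpha>)) * (v powr (a - 1) * (1 - v) powr (d - 1))))"
        by (simp only: mult_ac)
      also have "\<dots> = ennreal \<alpha> * (ennreal q * ((\<phi> (q * v) * ennreal ((q * v) powr (a - 1))) * ennreal ((q * (1 - v)) powr (d - 1) * q powr (- c) * exp (- (q powr \<alpha>)))))"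
        unfolding eq by (simp only: mult_ac)
      finally show ?thesis unfolding s1 sum .
    qed
    then show "ennreal (\<alpha> * q powr (\<alpha> - 1)) * (\<integral>\<^sup>+v\<in>{0<..<1}. \<phi> ((q powr \<alpha>) powr (1 / \<alpha>) * v)
            * ennreal ((q powr \<alpha>) powr (b / \<alpha> - 1) * exp (- (q powr \<alpha>)) * (v powr (a - 1) * (1 - v) powr (d - 1))) \<partial>lborel)
        = ennreal \<alpha> * (\<integral>\<^sup>+v\<in>{0<..<1}. ennreal q * ?H (q * v) (q * (1 - v)) \<partial>lborel)"
      by (subst (1 2) set_nn_integral_mult_left[symmetric]; (measurable)?) (rule set_nn_integral_eqI, blast)
  qed
  also have "\<dots> = ennreal \<alpha> * (\<integral>\<^sup>+q\<in>{0<..}. (\<integral>\<^sup>+v\<in>{0<..<1}. ennreal q * ?H (q * v) (q * (1 - v)) \<partial>lborel) \<partial>lborel)"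
    by (rule set_nn_integral_mult_left) measurable
  also have "(\<integral>\<^sup>+q\<in>{0<..}. (\<integral>\<^sup>+v\<in>{0<..<1}. ennreal q * ?H (q * v) (q * (1 - v)) \<partial>lborel) \<partial>lborel)
      = (\<integral>\<^sup>+y\<in>{0<..}. (\<integral>\<^sup>+z\<in>{0<..}. ?H y z \<partial>lborel) \<partial>lborel)"
    by (rule nn_integral_polar) measurable
  also have "\<dots> = (\<integral>\<^sup>+y\<in>{0<..}. \<phi> y * ennreal (y powr (a - 1)) * shifted_weight \<alpha> c d y \<partial>lborel)"
    unfolding shifted_weight_def by (intro set_nn_integral_eqI set_nn_integral_mult_left) measurable
  finally show ?thesis .
qed

section \<open>The weights of the Poisson-Kingman model\<close>

text \<open>
  The function \<open>h\<close> is constrained only on the half-line that carries the gamma law, so that its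
  arbitrary, possibly not measurable, values elsewhere do not matter. The same purpose is served by
  \<open>\<phi>\<close> in the next lemma.
\<close>

lemma nn_integral_gamma_law:
  assumes [measurable]: "h' \<in> borel_measurable borel" and h: "\<And>x. 0 < x \<Longrightarrow> h x = h' x" and a: "0 < a"
  shows "(\<integral>\<^sup>+x. h x \<partial>gamma_law a)
       = ennreal (1 / Gamma a) * (\<integral>\<^sup>+x\<in>{0<..}. h' x * ennreal (x powr (a - 1) * exp (- x)) \<partial>lborel)"
proof -
  have G: "0 < Gamma a" using a by (rule Gamma_real_pos)
  have "AE x in gamma_law a. h x = h' x"
    unfolding gamma_law_def by (subst AE_density) (auto simp: h)
  then have "(\<integral>\<^sup>+x. h x \<partial>gamma_law a) = (\<integral>\<^sup>+x. h' x \<partial>gamma_law a)"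
    by (rule nn_integral_cong_AE)
  also have "\<dots> = (\<integral>\<^sup>+x\<in>{0<..}. ennreal (1 / Gamma a) * (h' x * ennreal (x powr (a - 1) * exp (- x))) \<partial>lborel)"
    unfolding gamma_law_def
    using G by (subst nn_integral_density)
      (auto intro!: nn_integral_cong simp: ennreal_mult[symmetric] divide_inverse mult_ac split: split_indicator)
  also have "\<dots> = ennreal (1 / Gamma a) * (\<integral>\<^sup>+x\<in>{0<..}. h' x * ennreal (x powr (a - 1) * exp (- x)) \<partial>lborel)"
    by (rule set_nn_integral_mult_left) measurable
  finally show ?thesis .
qed

lemma E_gamma_beta_eq_integral:
  fixes \<phi> :: "real \<Rightarrow> ennreal"
  assumes \<phi> [measurable]: "\<phi> \<in> borel_measurable borel"
    and g: "\<And>y. 0 < y \<Longrightarrow> ennreal (g (y powr \<alpha>)) = \<phi> y"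
    and \<alpha>: "0 < \<alpha>" and pos: "0 < p" "0 < a" "0 < d"
  shows "E_gamma_beta \<alpha> g p a d = ennreal (1 / (Gamma p * Beta a d)) *
     (\<integral>\<^sup>+x\<in>{0<..}. (\<integral>\<^sup>+v\<in>{0<..<1}. \<phi> (x powr (1 / \<alpha>) * v)
        * ennreal (x powr (p - 1) * exp (- x) * (v powr (a - 1) * (1 - v) powr (d - 1))) \<partial>lborel) \<partial>lborel)"
proof -
  have G: "0 < Gamma p" using pos by (intro Gamma_real_pos)
  have B: "0 < Beta a d" using pos by (auto simp: Beta_def intro!: divide_pos_pos mult_pos_pos Gamma_real_pos)
  define wg where "wg x = ennreal (if 0 < x then x powr (p - 1) * exp (- x) / Gamma p else 0)" for x :: real
  define wb where "wb v = ennreal (if 0 < v \<and> v < 1 then v powr (a - 1) * (1 - v) powr (d - 1) / Beta a d else 0)" for v :: real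
  have [measurable]: "wg \<in> borel_measurable borel" "wb \<in> borel_measurable borel"
    unfolding wg_def[abs_def] wb_def[abs_def] by measurable
  have sf: "sigma_finite_measure (density lborel wb)"
    by (subst sigma_finite_measure.sigma_finite_iff_density_finite[OF lborel.sigma_finite_measure_axioms]) (auto simp: wb_def)
  have pair: "gamma_law p \<Otimes>\<^sub>M beta_law a d = density (lborel \<Otimes>\<^sub>M lborel) (\<lambda>(x, v). wg x * wb v)"
    unfolding gamma_law_def beta_law_def wg_def[symmetric] wb_def[symmetric]
    by (rule pair_measure_density) (auto simp: sf lborel.sigma_finite_measure_axioms)
  let ?h = "\<lambda>q. \<phi> (fst q powr (1 / \<alpha>) * snd q)"
  have "AE q in density (lborel \<Otimes>\<^sub>M lborel) (\<lambda>(x, v). wg x * wb v). ennreal (g (fst q * snd q powr \<alpha>)) = ?h q"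
  proof (subst AE_density, measurable, rule AE_I2, rule impI)
    fix q :: "real \<times> real" assume "0 < (case q of (x, v) \<Rightarrow> wg x * wb v)"
    then have "wg (fst q) \<noteq> 0" "wb (snd q) \<noteq> 0" by (auto simp: split_beta)
    then have q: "0 < fst q" "0 < snd q" by (auto simp: wg_def wb_def split: if_splits)
    then have "fst q * snd q powr \<alpha> = (fst q powr (1 / \<alpha>) * snd q) powr \<alpha>"
      using \<alpha> by (simp add: powr_mult powr_powr)
    then show "ennreal (g (fst q * snd q powr \<alpha>)) = ?h q" using q g by simp
  qed
  then have "E_gamma_beta \<alpha> g p a d = (\<integral>\<^sup>+q. ?h q \<partial>density (lborel \<Otimes>\<^sub>M lborel) (\<lambda>(x, v). wg x * wb v))"
    unfolding E_gamma_beta_def pair by (rule nn_integral_cong_AE)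
  also have "\<dots> = (\<integral>\<^sup>+q. (case q of (x, v) \<Rightarrow> wg x * wb v) * ?h q \<partial>(lborel \<Otimes>\<^sub>M lborel))"
    by (rule nn_integral_density) measurable
  also have "\<dots> = (\<integral>\<^sup>+x. \<integral>\<^sup>+v. wg x * wb v * \<phi> (x powr (1 / \<alpha>) * v) \<partial>lborel \<partial>lborel)"
    by (subst lborel.nn_integral_fst[symmetric]) auto
  also have "\<dots> = (\<integral>\<^sup>+x\<in>{0<..}. ennreal (1 / (Gamma p * Beta a d)) * (\<integral>\<^sup>+v\<in>{0<..<1}. \<phi> (x powr (1 / \<alpha>) * v)
        * ennreal (x powr (p - 1) * exp (- x) * (v powr (a - 1) * (1 - v) powr (d - 1))) \<partial>lborel) \<partial>lborel)"
  proof (rule nn_integral_cong)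
    fix x :: real
    show "(\<integral>\<^sup>+v. wg x * wb v * \<phi> (x powr (1 / \<alpha>) * v) \<partial>lborel) =
       ennreal (1 / (Gamma p * Beta a d)) * (\<integral>\<^sup>+v\<in>{0<..<1}. \<phi> (x powr (1 / \<alpha>) * v)
        * ennreal (x powr (p - 1) * exp (- x) * (v powr (a - 1) * (1 - v) powr (d - 1))) \<partial>lborel) * indicator {0<..} x"
    proof (cases "0 < x")
      case True
      then show ?thesis
        by (subst set_nn_integral_mult_left[symmetric])
          (use G B in \<open>auto intro!: nn_integral_cong simp: wg_def wb_def ennreal_mult[symmetric] divide_inverse mult_ac split: split_indicator\<close>)
    qed (simp add: wg_def)
  qed
  also have "\<dots> = ennreal (1 / (Gamma p * Beta a d)) * (\<integral>\<^sup>+x\<in>{0<..}. (\<integral>\<^sup>+v\<in>{0<..<1}. \<phi> (x powr (1 / \<alpha>) * v)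
        * ennreal (x powr (p - 1) * exp (- x) * (v powr (a - 1) * (1 - v) powr (d - 1))) \<partial>lborel) \<partial>lborel)"
    by (rule set_nn_integral_mult_left) measurable
  finally show ?thesis .
qed

text \<open>
  With \<open>a = \<theta> + \<alpha>\<close>, \<open>b = \<theta> + k \<alpha>\<close>, \<open>c = n - k \<alpha>\<close> and
  \<open>d = n - \<alpha>\<close>, so that \<open>a + d = b + c = n + \<theta>\<close>, both sides are explicit
  multiples of the integral \<open>R\<close> of \<open>\<phi>\<close> against \<open>shifted_weight\<close>, and it
  remains to compare gamma factors.
\<close>

lemma PK_V_mixing_density:
  fixes \<alpha> \<theta> :: real and f g :: "real \<Rightarrow> real"
  assumes \<alpha>: "0 < \<alpha>" "\<alpha> < 1" and \<theta>: "- \<alpha> < \<theta>"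
    and f: "positive_stable_density \<alpha> f"
    and g: "g \<in> borel_measurable (restrict_space borel {0<..})"
    and k: "1 \<le> k" "k \<le> n"
  shows "PK_V f \<alpha> (mixing_density f \<alpha> \<theta> g) n k =
        ennreal (\<alpha> ^ (k - 1) * Gamma (\<theta> + 1) * Gamma (\<theta> / \<alpha> + real k)
          / (Gamma (\<theta> / \<alpha> + 1) * Gamma (real n + \<theta>))) * Sigma_const \<alpha> \<theta> g
        * E_gamma_beta \<alpha> g (\<theta> / \<alpha> + real k) (\<theta> + \<alpha>) (real n - \<alpha>)"
proof -
  define a b c d where "a = \<theta> + \<alpha>" and "b = \<theta> + real k * \<alpha>" and "c = real n - real k * \<alpha>" and "d = real n - \<alpha>"
  have "real k * \<alpha> < real k" "real k \<le> real n" using k \<alpha> by auto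
  then have c: "0 < c" unfolding c_def by linarith
  have a: "0 < a" using \<theta> by (simp add: a_def)
  have d: "0 < d" using k \<alpha> by (simp add: d_def)
  have "\<alpha> \<le> real k * \<alpha>" using k \<alpha> by (simp add: mult_le_cancel_right1)
  then have b: "0 < b" using \<theta> by (simp add: b_def)
  have abcd: "a + d = b + c" and ad: "a + d = real n + \<theta>" by (simp_all add: a_def b_def c_def d_def)
  have p: "\<theta> / \<alpha> + real k = b / \<alpha>" using \<alpha> by (simp add: b_def field_simps)
  have "0 < \<theta> / \<alpha> + 1" using \<theta> \<alpha> by (simp add: field_simps)
  then have G: "0 < Gamma a" "0 < Gamma c" "0 < Gamma d" "0 < Gamma (a + d)" "0 < Gamma (b / \<alpha>)"
    "0 < Gamma (\<theta> + 1)" "0 < Gamma (\<theta> / \<alpha> + 1)"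
    using a b c d \<alpha> \<theta> by (auto intro!: Gamma_real_pos)
  define F where "F t = ennreal (f t) * indicator {0<..} t" for t
  have f_meas: "f \<in> borel_measurable (restrict_space borel {0<..})"
    and f_nn: "\<And>t. 0 < t \<Longrightarrow> 0 \<le> f t"
    and f_lap: "\<And>s. 0 \<le> s \<Longrightarrow> (\<integral>\<^sup>+t\<in>{0<..}. ennreal (exp (- (s * t)) * f t) \<partial>lborel) = ennreal (exp (- (s powr \<alpha>)))"
    using f by (auto simp: positive_stable_density_def)
  have F [measurable]: "F \<in> borel_measurable borel"
    unfolding F_def[abs_def] using measurable_compose[OF f_meas measurable_ennreal]
    by (subst borel_measurable_restrict_space_iff_ennreal[symmetric]) auto
  have F_lap: "(\<integral>\<^sup>+t\<in>{0<..}. ennreal (exp (- (s * t))) * F t \<partial>lborel) = ennreal (exp (- (s powr \<alpha>)))" if "0 \<le> s" for s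
    unfolding f_lap[OF that, symmetric]
    by (rule set_nn_integral_eqI) (auto simp: F_def f_nn ennreal_mult)
  \<comment> \<open>The function \<open>g\<close> precomposed with the power \<open>\<alpha>\<close>, truncated to be measurable on the whole line.\<close>
  define \<phi> where "\<phi> y = ennreal (g (y powr \<alpha>)) * indicator {0<..} (y powr \<alpha>)" for y
  have "(\<lambda>x. ennreal (g x) * indicator {0<..} x) \<in> borel_measurable borel"
    using measurable_compose[OF g measurable_ennreal]
    by (subst borel_measurable_restrict_space_iff_ennreal[symmetric]) auto
  from measurable_compose[OF _ this, of "\<lambda>y. y powr \<alpha>" borel]
  have \<phi> [measurable]: "\<phi> \<in> borel_measurable borel" unfolding \<phi>_def[abs_def] by simp
  have g_\<phi>: "ennreal (g (y powr \<alpha>)) = \<phi> y" if "0 < y" for y using that by (simp add: \<phi>_def)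
  define I where "I t = (\<integral>\<^sup>+u\<in>{0<..<1}. F (t * u) * ennreal ((1 - u) powr (c - 1)) \<partial>lborel)" for t
  define X where "X t = (\<integral>\<^sup>+x\<in>{0<..}. \<phi> (x / t) * ennreal (x powr (a - 1) * exp (- x)) \<partial>lborel)" for t
  have [measurable]: "I \<in> borel_measurable borel" "X \<in> borel_measurable borel"
    unfolding I_def[abs_def] X_def[abs_def] by measurable
  define R where "R = (\<integral>\<^sup>+y\<in>{0<..}. \<phi> y * ennreal (y powr (a - 1)) * shifted_weight \<alpha> c d y \<partial>lborel)"
  define S where "S = Sigma_const \<alpha> \<theta> g"
  define K where "K = \<alpha> ^ k / Gamma c * (Gamma (\<theta> + 1) / Gamma (\<theta> / \<alpha> + 1)) / Gamma a"
  have K: "0 \<le> K" using G \<alpha> by (simp add: K_def)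
  \<comment> \<open>The factor \<open>f t\<close> of the mixing density cancels the denominator of \<open>GG\<close>, provided that it is not zero.\<close>
  have integrand: "GG f \<alpha> n k t * mixing_density f \<alpha> \<theta> g t = (ennreal K * S) * (ennreal (t powr (- b)) * I t * X t)"
    if t: "0 < t" and nz: "F t \<noteq> 0" for t
  proof -
    have ft: "0 < f t" using nz t f_nn[of t] by (auto simp: F_def less_le)
    have 1: "(\<integral>\<^sup>+u\<in>{0<..<1}. ennreal (f (t * u) * (1 - u) powr (c - 1)) \<partial>lborel) = I t"
      unfolding I_def using t f_nn by (intro set_nn_integral_eqI) (auto simp: F_def ennreal_mult'')
    have 2: "(\<integral>\<^sup>+x. ennreal (g (x powr \<alpha> / t powr \<alpha>)) \<partial>gamma_law a) = ennreal (1 / Gamma a) * X t"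
      unfolding X_def using t by (intro nn_integral_gamma_law a) (auto simp: g_\<phi>[symmetric] powr_divide)
    have e: "- b = - (real k * \<alpha>) + (- \<theta>)" by (simp add: b_def)
    have "\<alpha> ^ k * t powr (- (real k * \<alpha>)) / (Gamma c * f t) * ((1 / Gamma a) * (Gamma (\<theta> + 1) / Gamma (\<theta> / \<alpha> + 1) * t powr (- \<theta>) * f t))
        = K * t powr (- b)"
      unfolding e powr_add K_def using ft by (simp add: mult_ac)
    then have 3: "ennreal (\<alpha> ^ k * t powr (- (real k * \<alpha>)) / (Gamma c * f t)) * (ennreal (1 / Gamma a) * ennreal (Gamma (\<theta> + 1) / Gamma (\<theta> / \<alpha> + 1) * t powr (- \<theta>) * f t))
        = ennreal K * ennreal (t powr (- b))"
      using ft G \<alpha> K by (simp add: ennreal_mult[symmetric])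
    have "GG f \<alpha> n k t * mixing_density f \<alpha> \<theta> g t
       = ennreal (\<alpha> ^ k * t powr (- (real k * \<alpha>)) / (Gamma c * f t)) * I t
         * (S * (ennreal (1 / Gamma a) * X t) * ennreal (Gamma (\<theta> + 1) / Gamma (\<theta> / \<alpha> + 1) * t powr (- \<theta>) * f t))"
      unfolding GG_def mixing_density_def tilted_stable_density_def c_def[symmetric] a_def[symmetric] S_def[symmetric] 1 2 ..
    also have "\<dots> = (ennreal (\<alpha> ^ k * t powr (- (real k * \<alpha>)) / (Gamma c * f t)) * (ennreal (1 / Gamma a) * ennreal (Gamma (\<theta> + 1) / Gamma (\<theta> / \<alpha> + 1) * t powr (- \<theta>) * f t)))
          * (S * I t * X t)"
      by (simp only: mult_ac)
    also have "\<dots> = (ennreal K * S) * (ennreal (t powr (- b)) * I t * X t)"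
      unfolding 3 by (simp only: mult_ac)
    finally show ?thesis .
  qed
  have "AE t in lborel. 0 < t \<longrightarrow> F t \<noteq> 0"
    by (rule stable_density_positive[OF F \<alpha>]) (rule F_lap)
  then have "PK_V f \<alpha> (mixing_density f \<alpha> \<theta> g) n k
      = (\<integral>\<^sup>+t\<in>{0<..}. (ennreal K * S) * (ennreal (t powr (- b)) * I t * X t) \<partial>lborel)"
    unfolding PK_V_def
    by (intro nn_integral_cong_AE, elim eventually_mono) (auto simp: integrand split: split_indicator)
  also have "\<dots> = (ennreal K * S) * (\<integral>\<^sup>+t\<in>{0<..}. ennreal (t powr (- b)) * I t * X t \<partial>lborel)"
    by (rule set_nn_integral_mult_left) measurable
  also have "(\<integral>\<^sup>+t\<in>{0<..}. ennreal (t powr (- b)) * I t * X t \<partial>lborel) = ennreal (Gamma c / Gamma d) * R"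
    unfolding I_def X_def R_def
    by (rule stable_gamma_mixture[OF F \<phi> _ c d abcd]) (simp add: F_lap)
  finally have V: "PK_V f \<alpha> (mixing_density f \<alpha> \<theta> g) n k = (ennreal K * ennreal (Gamma c / Gamma d)) * (S * R)"
    by (simp only: mult_ac)
  have bp: "0 < b / \<alpha>" using b \<alpha> by simp
  have E: "E_gamma_beta \<alpha> g (b / \<alpha>) a d = ennreal (1 / (Gamma (b / \<alpha>) * Beta a d)) * (ennreal \<alpha> * R)"
    using E_gamma_beta_eq_integral[OF \<phi>, of g \<alpha> "b / \<alpha>" a d] gamma_beta_mixture[OF \<phi> \<alpha>(1) abcd] g_\<phi> \<alpha>(1) bp a d
    by (simp add: R_def)
  let ?L = "\<alpha> ^ (k - 1) * Gamma (\<theta> + 1) * Gamma (b / \<alpha>) / (Gamma (\<theta> / \<alpha> + 1) * Gamma (a + d))"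
  have "\<alpha> ^ k = \<alpha> * \<alpha> ^ (k - 1)" using k by (cases k) auto
  then have "K * (Gamma c / Gamma d) = ?L * (1 / (Gamma (b / \<alpha>) * Beta a d) * \<alpha>)"
    using G \<alpha> by (simp add: K_def Beta_def field_simps)
  moreover have "0 \<le> 1 / (Gamma (b / \<alpha>) * Beta a d)" using G by (simp add: Beta_def)
  moreover have "0 \<le> ?L" using G \<alpha> by simp
  ultimately have "ennreal K * ennreal (Gamma c / Gamma d)
      = ennreal ?L * (ennreal (1 / (Gamma (b / \<alpha>) * Beta a d)) * ennreal \<alpha>)"
    using K G \<alpha> by (simp only: ennreal_mult[symmetric] divide_nonneg_pos mult_nonneg_nonneg less_imp_le)
  then have "PK_V f \<alpha> (mixing_density f \<alpha> \<theta> g) n k = ennreal ?L * S * E_gamma_beta \<alpha> g (b / \<alpha>) a d"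
    unfolding V E by (simp only: mult_ac)
  then show ?thesis by (simp only: p ad S_def a_def[symmetric] d_def[symmetric])
qed

theorem proposition7p4:
  fixes \<alpha> \<theta> :: real and f g :: "real \<Rightarrow> real"
  assumes "0 < \<alpha>" and "\<alpha> < 1" and "- \<alpha> < \<theta>"
    and "positive_stable_density \<alpha> f"
    and "g \<in> borel_measurable (restrict_space borel {0<..})"
    and "\<And>x. 0 < x \<Longrightarrow> 0 \<le> g x"
    and "0 < E_gamma_beta \<alpha> g (\<theta> / \<alpha> + 1) (\<theta> + \<alpha>) (1 - \<alpha>)"
    and "E_gamma_beta \<alpha> g (\<theta> / \<alpha> + 1) (\<theta> + \<alpha>) (1 - \<alpha>) < \<infinity>"
  shows "(\<forall>n::nat. 1 \<le> n \<longrightarrow>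
      PK_V f \<alpha> (mixing_density f \<alpha> \<theta> g) n 1 =
        ennreal (Gamma (\<theta> + 1) / Gamma (real n + \<theta>)) * Sigma_const \<alpha> \<theta> g
        * E_gamma_beta \<alpha> g (\<theta> / \<alpha> + 1) (\<theta> + \<alpha>) (real n - \<alpha>)) \<and>
    (\<forall>(n::nat) (k::nat). 1 \<le> k \<and> k \<le> n \<longrightarrow>
      PK_V f \<alpha> (mixing_density f \<alpha> \<theta> g) n k =
        ennreal (\<alpha> ^ (k - 1) * Gamma (\<theta> + 1) * Gamma (\<theta> / \<alpha> + real k)
          / (Gamma (\<theta> / \<alpha> + 1) * Gamma (real n + \<theta>))) * Sigma_const \<alpha> \<theta> g
        * E_gamma_beta \<alpha> g (\<theta> / \<alpha> + real k) (\<theta> + \<alpha>) (real n - \<alpha>))"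
proof (intro conjI allI impI)
  note V = PK_V_mixing_density[OF assms(1-5)]
  fix n :: nat assume n: "1 \<le> n"
  have "0 < \<theta> / \<alpha> + 1" using assms(1,3) by (simp add: field_simps)
  then have "Gamma (\<theta> / \<alpha> + 1) \<noteq> 0" using Gamma_real_pos by (metis less_irrefl)
  then show "PK_V f \<alpha> (mixing_density f \<alpha> \<theta> g) n 1 =
        ennreal (Gamma (\<theta> + 1) / Gamma (real n + \<theta>)) * Sigma_const \<alpha> \<theta> g
        * E_gamma_beta \<alpha> g (\<theta> / \<alpha> + 1) (\<theta> + \<alpha>) (real n - \<alpha>)"
    using V[of 1 n] n by simp
next
  note V = PK_V_mixing_density[OF assms(1-5)]
  fix n k :: nat assume "1 \<le> k \<and> k \<le> n"
  then show "PK_V f \<alpha> (mixing_density f \<alpha> \<theta> g) n k =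
        ennreal (\<alpha> ^ (k - 1) * Gamma (\<theta> + 1) * Gamma (\<theta> / \<alpha> + real k)
          / (Gamma (\<theta> / \<alpha> + 1) * Gamma (real n + \<theta>))) * Sigma_const \<alpha> \<theta> g
        * E_gamma_beta \<alpha> g (\<theta> / \<alpha> + real k) (\<theta> + \<alpha>) (real n - \<alpha>)"
    by (intro V) auto
qed

end
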